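(* Assume the standing setting with (A2) and (A3), and let $\alpha\in(0,1]$, $\tilde\lambda_\alpha=\sqrt{(1+\log(1/\alpha))/2}$. Define $$\hat m_0=\max\Big\{n\in\{0,\dots,m\}:\forall t\in[0,1],\ \sum_{j=1}^n(\mathbb G(t))_{(j)}\le\tilde\lambda_\alpha\sqrt n\Big\},$$ let $\sigma$ be a permutation with $p_{\sigma(1)}\le\dots\le p_{\sigma(m)}$, $p_{(k)}=p_{\sigma(k)}$, $R_k=\{\sigma(1),\dots,\sigma(k)\}$, and $$\zeta_k=k\wedge\hat m_0\wedge\Big\lfloor\sum_{i=1}^{\hat m_0}(\mathbf F(p_{(k)}))_{[i]}+\sqrt{\hat m_0}\,\tilde\lambda_\alpha\Big\rfloor,\qquad\mathfrak R=(R_k,\zeta_k)_{1\le k\le m}.$$ Then $\hat V^{\mathrm{JER}}_{\mathfrak R}$ is a confidence bound at level $\alpha$: $\mathbb P_\mu\big(\forall S\subseteq\{1,\dots,m\},\ |S\cap\mathcal H_0(\mu)|\le\hat V^{\mathrm{JER}}_{\mathfrak R}(S)\big)\ge1-\alpha$ for all $\mu\in\mathfrak F$.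
   Context: Standing setting: $X\sim\mu\in\mathfrak F$, null hypotheses $H_i\subseteq\mathfrak F$, $\mathcal H_0(\mu)=\{i:\mu\in H_i\}$, $m_0=|\mathcal H_0|$, $p$-values $p_i\in[0,1]$. (A2): $(p_i)_{i\in\mathcal H_0}$ independent. (A3): known nondecreasing $F_i$ with $\mathbb P_\mu(p_i\le x)\le F_i(x)$ for all $x$ whenever $i\in\mathcal H_0(\mu)$. $\mathbb G_i(t)=\mathbf 1\{p_i\le t\}-F_i(t)$, $(\mathbb G(t))_{(j)}$ the $j$-th smallest of $\mathbb G_1(t),\dots,\mathbb G_m(t)$; $\mathbf F(t)=(F_1(t),\dots,F_m(t))$, $(\mathbf F(t))_{[i]}$ its $i$-th largest coordinate; empty sums are $0$. For a reference family: $\mathfrak A(\mathfrak R)=\{A\subseteq\{1,\dots,m\}:\forall k,|R_k\cap A|\le\zeta_k\}$, $\hat V^{\mathrm{JER}}_{\mathfrak R}(S)=\max_{A\in\mathfrak A(\mathfrak R)}|S\cap A|$.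
   Formalization: The functions F_i are additionally assumed nonnegative on [0,1]; (A3) implies this whenever H_i is nonempty, but if some H_i are empty and their F_i negative, the stated coverage can fail. *)

theory Defs
  imports "HOL-Probability.Probability"
begin

text \<open>Hypotheses are indexed by 1..m.  pv :: nat => real is a realization of the p-value
vector, F i the known bound functions.\<close>

definition lambda_tilde :: "real \<Rightarrow> real" where
  "lambda_tilde \<alpha> = sqrt ((1 + ln (1 / \<alpha>)) / 2)"

definition Gvec :: "nat \<Rightarrow> (nat \<Rightarrow> real \<Rightarrow> real) \<Rightarrow> (nat \<Rightarrow> real) \<Rightarrow> real \<Rightarrow> real list" where
  "Gvec m F pv t = map (\<lambda>i. (if pv i \<le> t then 1 else 0) - F i t) [1..<m+1]"

definition Fvec :: "nat \<Rightarrow> (nat \<Rightarrow> real \<Rightarrow> real) \<Rightarrow> real \<Rightarrow> real list" where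
  "Fvec m F t = map (\<lambda>i. F i t) [1..<m+1]"

definition sum_smallest :: "nat \<Rightarrow> real list \<Rightarrow> real" where
  "sum_smallest n xs = sum_list (take n (sort xs))"

definition sum_largest :: "nat \<Rightarrow> real list \<Rightarrow> real" where
  "sum_largest n xs = sum_list (take n (rev (sort xs)))"

definition m0_hat :: "nat \<Rightarrow> (nat \<Rightarrow> real \<Rightarrow> real) \<Rightarrow> real \<Rightarrow> (nat \<Rightarrow> real) \<Rightarrow> nat" where
  "m0_hat m F lam pv =
     Max {n \<in> {0..m}. \<forall>t \<in> {0..1}. sum_smallest n (Gvec m F pv t) \<le> lam * sqrt (real n)}"

definition R_sets :: "(nat \<Rightarrow> nat) \<Rightarrow> nat \<Rightarrow> nat set" where
  "R_sets \<sigma> k = \<sigma> ` {1..k}"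

definition zeta :: "nat \<Rightarrow> (nat \<Rightarrow> real \<Rightarrow> real) \<Rightarrow> real \<Rightarrow> (nat \<Rightarrow> real) \<Rightarrow> (nat \<Rightarrow> nat) \<Rightarrow> nat \<Rightarrow> int" where
  "zeta m F lam pv \<sigma> k =
     (let h = m0_hat m F lam pv in
      min (int k) (min (int h)
        \<lfloor>sum_largest h (Fvec m F (pv (\<sigma> k))) + sqrt (real h) * lam\<rfloor>))"

definition JER_family :: "nat \<Rightarrow> (nat \<Rightarrow> nat set) \<Rightarrow> (nat \<Rightarrow> int) \<Rightarrow> nat set set" where
  "JER_family m R \<zeta> = {A. A \<subseteq> {1..m} \<and> (\<forall>k \<in> {1..m}. int (card (R k \<inter> A)) \<le> \<zeta> k)}"

definition V_JER :: "nat \<Rightarrow> (nat \<Rightarrow> nat set) \<Rightarrow> (nat \<Rightarrow> int) \<Rightarrow> nat set \<Rightarrow> nat" where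
  "V_JER m R \<zeta> S = Max ((\<lambda>A. card (S \<inter> A)) ` JER_family m R \<zeta>)"

end

theory Submission
  imports Defs
begin

text \<open>
  Write \<open>n = |H0|\<close>.  The theorem follows, deterministically, from the one-sided inequality of Bretagnolle: for
  independent real variables with arbitrary distributions, the supremum \<open>D\<close> of the centred counting process exceeds
  \<open>c\<close> with probability at most \<open>exp (1 - 2 c\<^sup>2 / n)\<close>.

  After rounding the variables to finitely many ordered cells, \<open>E (D - a)\<^sub>+\<close> can only grow when the distributions of two
  of the variables are mixed, because as a function of the cells of two variables \<open>(D - a)\<^sub>+\<close> is a conditionally
  positive semidefinite kernel.  Finitely many such mixings make all distributions equal to their average.
  For identically distributed variables the probability that \<open>D \<ge> y\<close> is at most the expectation of
  \<open>n (n - 1) \<cdots> (n - \<tau> + 1) / n ^ \<tau>\<close>, where \<open>\<tau>\<close> is the number of independent uniform variables on \<open>[0, 1]\<close> needed to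
  reach the sum \<open>y\<close>.  Integrating over \<open>y \<ge> a\<close> gives \<open>b E (D - a)\<^sub>+ \<le> exp (n b\<^sup>2 / 8 - b a)\<close> for all \<open>b > 0\<close>, and Markov's
  inequality for \<open>(D - a)\<^sub>+\<close> with \<open>b = 4 c / n\<close> and \<open>a = c - 1 / b\<close> costs exactly the factor \<open>exp 1\<close>.
\<close>

section \<open>First passage of sums of uniform variables and crossing polynomials\<close>

text \<open>Convolution with the uniform density on [0, 1]: the mean of \<open>f (y - u)\<close>
  over a uniform \<open>u\<close>.\<close>

definition slide :: "(real \<Rightarrow> real) \<Rightarrow> real \<Rightarrow> real" where
  "slide f y = integral {y - 1..y} f"

lemma slide_diff:
  assumes int: "\<And>a b. f integrable_on {a..b}" and "A \<le> y - 1"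
  shows "slide f y = integral {A..y} f - integral {A..y - 1} f"
  using Henstock_Kurzweil_Integration.integral_combine[of A "y - 1" y f] assms
  by (simp add: slide_def)

lemma isCont_slide:
  assumes int: "\<And>a b. f integrable_on {a..b}"
  shows "isCont (slide f) y"
proof -
  \<comment> \<open>The base point lies below \<open>u - 1\<close> for all \<open>u\<close> near
    \<open>y\<close>, so \<open>slide f\<close> is locally a difference of two values of one
    indefinite integral.\<close>
  let ?I = "\<lambda>u. integral {y - 3..u} f"
  have c: "isCont ?I u" if "u \<in> {y - 2..y + 1}" for u
  proof -
    have "continuous_on {y - 3..y + 2} ?I"
      by (rule indefinite_integral_continuous_1[OF int])
    then show ?thesis
      using that by (intro continuous_on_interior[of "{y - 3..y + 2}"]) auto
  qed
  have "isCont (\<lambda>u. ?I u - ?I (u - 1)) y"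
    by (intro continuous_intros c isCont_o2[where g = ?I and f = "\<lambda>u. u - 1"]) auto
  moreover have "\<forall>\<^sub>F u in nhds y. slide f u = ?I u - ?I (u - 1)"
    by (rule eventually_nhds_in_open[of "{y - 1<..<y + 1}", THEN eventually_mono])
      (auto intro!: slide_diff[OF int])
  ultimately show ?thesis
    by (subst isCont_cong) auto
qed

lemma DERIV_slide:
  assumes int: "\<And>a b. f integrable_on {a..b}" and "isCont f y" "isCont f (y - 1)"
  shows "(slide f has_real_derivative f y - f (y - 1)) (at y)"
proof -
  let ?I = "\<lambda>u. integral {y - 3..u} f"
  have c: "(?I has_real_derivative f u) (at u)" if "u \<in> {y - 2..y + 1}" "isCont f u" for u
  proof -
    have "(?I has_vector_derivative f u) (at u within {y - 3..y + 2} - {})"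
      using that by (intro integral_has_vector_derivative_continuous_at[OF int])
        (auto intro: continuous_at_imp_continuous_at_within)
    then show ?thesis
      using that by (simp add: has_real_derivative_iff_has_vector_derivative
          at_within_interior[of u "{y - 3..y + 2}"])
  qed
  have "((\<lambda>u. ?I u - ?I (u - 1)) has_real_derivative f y - f (y - 1)) (at y)"
    using c[of y] c[of "y - 1"] assms DERIV_shift[of ?I "f (y - 1)" y "- 1"]
    by (intro DERIV_diff) auto
  moreover have "\<forall>\<^sub>F u in nhds y. slide f u = ?I u - ?I (u - 1)"
    by (rule eventually_nhds_in_open[of "{y - 1<..<y + 1}", THEN eventually_mono])
      (auto intro!: slide_diff[OF int])
  ultimately show ?thesis
    by (subst DERIV_cong_ev[OF refl _ refl]) auto
qed

text \<open>Every \<open>passage k\<close> has this shape: constant up to 0, continuous beyond, with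
  at most a jump at 0.\<close>

lemma integrable_piecewise_at_0:
  fixes g :: "real \<Rightarrow> real"
  assumes "\<And>y. isCont g y"
  shows "(\<lambda>y. if y \<le> 0 then C else g y) integrable_on {a..b}" (is "?f integrable_on _")
proof -
  define a' b' where "a' = min a 0" and "b' = max b 0"
  have "?f integrable_on {a'..0}"
    by (rule integrable_eq[of "\<lambda>_. C"]) auto
  moreover have "?f integrable_on {0..b'}"
    by (rule integrable_spike_finite[of "{0}" _ _ g])
      (auto intro!: integrable_continuous_real continuous_at_imp_continuous_on assms)
  ultimately have "?f integrable_on {a'..b'}"
    by (rule Henstock_Kurzweil_Integration.integrable_combine[rotated 2]) (auto simp: a'_def b'_def)
  then show ?thesis
    by (rule integrable_on_subinterval) (auto simp: a'_def b'_def)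
qed

text \<open>\<open>passage k y\<close> is the probability that the sum of \<open>k\<close>, but of no fewer, independent uniform variables on
  \<open>[0, 1]\<close> is at least \<open>y\<close>.\<close>

fun passage :: "nat \<Rightarrow> real \<Rightarrow> real" where
  "passage 0 y = (if y \<le> 0 then 1 else 0)"
| "passage (Suc k) y = (if y \<le> 0 then 0 else slide (passage k) y)"

lemma passage_integrable: "passage k integrable_on {a..b}"
proof (induction k arbitrary: a b)
  case 0
  then show ?case
    using integrable_piecewise_at_0[of "\<lambda>_. 0" 1 a b] by (simp add: passage.simps[abs_def])
next
  case (Suc k)
  then show ?case
    using integrable_piecewise_at_0[OF isCont_slide[OF Suc], of 0 a b]
    by (simp add: passage.simps[abs_def])
qed

lemma isCont_passage:
  assumes "y \<noteq> 0"
  shows "isCont (passage k) y"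
proof -
  obtain C g where eq: "passage k = (\<lambda>y. if y \<le> 0 then C else g y)" and g: "\<And>y. isCont g y"
    by (cases k) (auto simp: passage.simps[abs_def] intro: that isCont_slide[OF passage_integrable]
        that[of 1 "\<lambda>_. 0"])
  show ?thesis
  proof (cases "y < 0")
    case True
    have "\<forall>\<^sub>F u in nhds y. passage k u = C"
      by (rule eventually_nhds_in_open[of "{..<0}", THEN eventually_mono]) (use True eq in auto)
    then show ?thesis by (subst isCont_cong) auto
  next
    case False
    have "\<forall>\<^sub>F u in nhds y. passage k u = g u"
      by (rule eventually_nhds_in_open[of "{0<..}", THEN eventually_mono]) (use False assms eq in auto)
    then show ?thesis by (subst isCont_cong) (auto simp: g)
  qed
qed

lemma passage_nonneg: "0 \<le> passage k y"
  by (induction k arbitrary: y) (auto simp: slide_def intro!: integral_nonneg passage_integrable)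

text \<open>The point 1 is left out because \<open>passage k\<close> may jump at
  \<open>y - 1 = 0\<close>.\<close>

lemma DERIV_passage_Suc:
  assumes "y > 0" "y \<noteq> 1"
  shows "(passage (Suc k) has_real_derivative passage k y - passage k (y - 1)) (at y)"
proof -
  have "(slide (passage k) has_real_derivative passage k y - passage k (y - 1)) (at y)"
    using assms by (intro DERIV_slide passage_integrable isCont_passage) auto
  moreover have "\<forall>\<^sub>F u in nhds y. passage (Suc k) u = slide (passage k) u"
    by (rule eventually_nhds_in_open[of "{0<..}", THEN eventually_mono]) (use assms in auto)
  ultimately show ?thesis
    by (subst DERIV_cong_ev[OF refl _ refl]) auto
qed

text \<open>For \<open>b \<ge> j - y\<close>, \<open>fact j * crossing_poly j b y\<close> is the volume of the points of \<open>[0, b]\<^sup>j\<close> whose counting process meets the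
  line \<open>t \<mapsto> y + t\<close>.\<close>

definition crossing_poly :: "nat \<Rightarrow> real \<Rightarrow> real \<Rightarrow> real" where
  "crossing_poly j b y = (\<Sum>k\<le>j. passage k y * (b ^ (j - k) / fact (j - k)))"

lemma crossing_poly_nonneg: "0 \<le> b \<Longrightarrow> 0 \<le> crossing_poly j b y"
  unfolding crossing_poly_def by (intro sum_nonneg mult_nonneg_nonneg passage_nonneg) auto

lemma crossing_poly_nonpos: 
  assumes "y \<le> 0" shows "crossing_poly j b y = b ^ j / fact j"
proof -
  have "crossing_poly j b y = (\<Sum>k\<le>j. if k = 0 then b ^ j / fact j else 0)"
    unfolding crossing_poly_def using assms
    by (intro sum.cong refl) (auto simp: gr0_conv_Suc)
  then show ?thesis by simp
qed

lemma crossing_poly_Suc_pos: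
  assumes "y > 0"
  shows "crossing_poly (Suc j) b y = (\<Sum>k\<le>j. passage (Suc k) y * (b ^ (j - k) / fact (j - k)))"
  unfolding crossing_poly_def using assms by (simp add: sum.atMost_Suc_shift del: sum.atMost_Suc)

lemma power_over_fact_add:
  fixes b d :: real
  shows "(b + d) ^ m / fact m = (\<Sum>i\<le>m. (d ^ i / fact i) * (b ^ (m - i) / fact (m - i)))"
proof -
  have "(b + d) ^ m = (\<Sum>i\<le>m. real (m choose i) * d ^ i * b ^ (m - i))"
    using binomial_ring[of d b m] by (simp add: add.commute)
  then show ?thesis
    by (simp add: sum_divide_distrib binomial_fact)
qed

text \<open>As a polynomial in the length, \<open>crossing_poly\<close> is a combination of divided
  powers, so the binomial theorem carries over (the Appell property).\<close>

lemma crossing_poly_add: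
  "crossing_poly j (b + d) y = (\<Sum>i\<le>j. (d ^ i / fact i) * crossing_poly (j - i) b y)"
proof -
  have "crossing_poly j (b + d) y = (\<Sum>k\<le>j. \<Sum>i\<le>j - k. passage k y * ((d ^ i / fact i) * (b ^ (j - k - i) / fact (j - k - i))))"
    unfolding crossing_poly_def by (simp add: power_over_fact_add sum_distrib_left)
  also have "\<dots> = (\<Sum>i\<le>j. \<Sum>k\<le>j - i. passage k y * ((d ^ i / fact i) * (b ^ (j - k - i) / fact (j - k - i))))"
    by (subst sum.Sigma, simp, simp, subst sum.Sigma, simp, simp,
        rule sum.reindex_bij_witness[of _ "\<lambda>(x, y). (y, x)" "\<lambda>(x, y). (y, x)"]) auto
  also have "\<dots> = (\<Sum>i\<le>j. (d ^ i / fact i) * crossing_poly (j - i) b y)"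
    unfolding crossing_poly_def
    by (intro sum.cong refl) (simp add: sum_distrib_left mult_ac add_ac)
  finally show ?thesis .
qed

lemma DERIV_power_over_fact:
  "((\<lambda>c. (E - c) ^ Suc m / fact (Suc m)) has_real_derivative - ((E - c) ^ m / fact m)) (at c)"
proof -
  have "((\<lambda>c. (E - c) ^ Suc m) has_real_derivative (1 + real m) * ((0 - 1) * (E - c) ^ m)) (at c)"
    by (intro DERIV_power_Suc DERIV_diff DERIV_const DERIV_ident)
  then have "((\<lambda>c. (E - c) ^ Suc m / fact (Suc m)) has_real_derivative
      (1 + real m) * ((0 - 1) * (E - c) ^ m) / fact (Suc m)) (at c)"
    by (rule DERIV_cdivide)
  also have "(1 + real m) * ((0 - 1) * (E - c) ^ m) / fact (Suc m) = - ((E - c) ^ m / fact m)"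
    unfolding fact_Suc by (simp add: divide_simps)
  finally show ?thesis .
qed

text \<open>Differentiating \<open>passage\<close> produces \<open>crossing_poly j\<close> at
  \<open>c\<close> minus its value at \<open>c - 1\<close>; differentiating the power of
  \<open>E - c\<close> cancels the first of these.\<close>

lemma DERIV_crossing_poly_antidiagonal:
  assumes "c > 0" "c \<noteq> 1"
  shows "((\<lambda>c. crossing_poly (Suc j) (E - c) c) has_real_derivative - crossing_poly j (E - c) (c - 1)) (at c)"
proof -
  have d: "((\<lambda>c. (E - c) ^ m / fact m) has_real_derivative
      (if m = 0 then 0 else - ((E - c) ^ (m - 1) / fact (m - 1)))) (at c)" for m
    using DERIV_power_over_fact[of E "m - 1" c] by (cases m) simp_all
  have "((\<lambda>c. \<Sum>k\<le>j. passage (Suc k) c * ((E - c) ^ (j - k) / fact (j - k))) has_real_derivative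
     (\<Sum>k\<le>j. passage (Suc k) c * (if j - k = 0 then 0 else - ((E - c) ^ (j - k - 1) / fact (j - k - 1)))
       + (passage k c - passage k (c - 1)) * ((E - c) ^ (j - k) / fact (j - k)))) (at c)"
    by (rule DERIV_sum, rule DERIV_mult'[OF DERIV_passage_Suc[OF assms] d])
  also have "(\<Sum>k\<le>j. passage (Suc k) c * (if j - k = 0 then 0 else - ((E - c) ^ (j - k - 1) / fact (j - k - 1)))
       + (passage k c - passage k (c - 1)) * ((E - c) ^ (j - k) / fact (j - k)))
     = (\<Sum>k\<le>j. passage (Suc k) c * (if j - k = 0 then 0 else - ((E - c) ^ (j - k - 1) / fact (j - k - 1))))
       + crossing_poly j (E - c) c - crossing_poly j (E - c) (c - 1)"
    by (simp add: crossing_poly_def sum.distrib sum_subtractf left_diff_distrib del: times_divide_eq_right)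
  \<comment> \<open>Lowering the exponent leads back to the sum in
    \<open>crossing_poly_Suc_pos\<close>; for \<open>j = 0\<close> both sides vanish because
    \<open>passage 0 c = 0\<close> for \<open>c > 0\<close>.\<close>
  also have "(\<Sum>k\<le>j. passage (Suc k) c * (if j - k = 0 then 0 else - ((E - c) ^ (j - k - 1) / fact (j - k - 1))))
     = - crossing_poly j (E - c) c"
  proof (cases j)
    case 0
    then show ?thesis using assms by (simp add: crossing_poly_def)
  next
    case (Suc i)
    have "(\<Sum>k\<le>j. passage (Suc k) c * (if j - k = 0 then 0 else - ((E - c) ^ (j - k - 1) / fact (j - k - 1))))
       = (\<Sum>k\<le>i. - (passage (Suc k) c * ((E - c) ^ (i - k) / fact (i - k))))"
      unfolding Suc by (simp add: Suc_diff_le)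
    then show ?thesis
      using crossing_poly_Suc_pos[OF assms(1), of i "E - c"] Suc by (simp add: sum_negf)
  qed
  finally have *: "((\<lambda>c. \<Sum>k\<le>j. passage (Suc k) c * ((E - c) ^ (j - k) / fact (j - k))) has_real_derivative
     - crossing_poly j (E - c) (c - 1)) (at c)" by simp
  have "\<forall>\<^sub>F u in nhds c. crossing_poly (Suc j) (E - u) u = (\<Sum>k\<le>j. passage (Suc k) u * ((E - u) ^ (j - k) / fact (j - k)))"
    by (rule eventually_nhds_in_open[of "{0<..}", THEN eventually_mono])
      (use assms crossing_poly_Suc_pos in auto)
  then show ?thesis
    using * by (subst DERIV_cong_ev[OF refl _ refl]) auto
qed

text \<open>Along \<open>b + y = E\<close> the derivative of \<open>crossing_poly (Suc j)\<close> involves only \<open>crossing_poly j\<close> at \<open>y - 1\<close>, to which the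
  induction hypothesis applies.\<close>

lemma crossing_poly_ge_power:
  assumes "0 \<le> b" "b \<le> real j - y"
  shows "b ^ j / fact j \<le> crossing_poly j b y"
  using assms
proof (induction j arbitrary: b y)
  case 0
  then show ?case by (simp add: crossing_poly_def)
next
  case (Suc j)
  show ?case
  proof (cases "y \<le> 0")
    case True
    then show ?thesis by (simp add: crossing_poly_nonpos)
  next
    case False
    define E where "E = b + y"
    define f where "f c = crossing_poly (Suc j) (E - c) c - (E - c) ^ Suc j / fact (Suc j)" for c
    define f' where "f' c = - crossing_poly j (E - c) (c - 1) + (E - c) ^ j / fact j" for c
    have "(f' has_integral (f E - f y)) {y..E}"
    proof (rule fundamental_theorem_of_calculus_interior_strong[of "{1}"])
      show "(f has_vector_derivative f' x) (at x)" if "x \<in> {y<..<E} - {1}" for x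
      proof -
        from DERIV_diff[OF DERIV_crossing_poly_antidiagonal[of x j E] DERIV_power_over_fact[of E j x]] that False
        show ?thesis
          by (simp add: f_def[abs_def] f'_def del: fact_Suc power_Suc flip: has_real_derivative_iff_has_vector_derivative)
      qed
      show "continuous_on {y..E} f"
        unfolding f_def crossing_poly_def using False
        by (intro continuous_intros continuous_at_imp_continuous_on ballI isCont_passage) auto
    qed (use Suc False in \<open>auto simp: E_def\<close>)
    moreover have "f' c \<le> 0" if "c \<in> {y..E}" for c
      using Suc.IH[of "E - c" "c - 1"] that Suc.prems by (simp add: f'_def E_def)
    ultimately have "f E - f y \<le> 0"
      by (rule has_integral_le[OF _ has_integral_0])
    \<comment> \<open>At \<open>c = E\<close> the length \<open>E - c\<close> is 0 and only the last
      summand survives. Since \<open>f\<close> does not increase, \<open>f y\<close> is at least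
      this nonnegative value.\<close>
    moreover have "f E = passage (Suc j) E"
    proof -
      have "crossing_poly (Suc j) 0 E = (\<Sum>k\<le>Suc j. if k = Suc j then passage (Suc j) E else 0)"
        unfolding crossing_poly_def by (intro sum.cong refl) (auto simp: power_0_left)
      then show ?thesis by (simp add: f_def)
    qed
    ultimately have "0 \<le> f y"
      using passage_nonneg[of "Suc j" E] by linarith
    then show ?thesis by (simp add: f_def E_def)
  qed
qed

section \<open>Numerical inequalities\<close>

text \<open>With \<open>x = b / 2\<close> this reads
  \<open>sinh x \<le> x * exp (x\<^sup>2 / 6)\<close>. It bounds \<open>(exp b - 1) / b\<close>, the
  moment generating function of a uniform variable on [0, 1], by that of a normal variable with the
  same mean 1/2 and variance 1/12.\<close>

lemma exp_minus_1_le: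
  fixes b :: real
  assumes "0 \<le> b"
  shows "exp b - 1 \<le> b * exp (b / 2 + b\<^sup>2 / 24)"
proof -
  \<comment> \<open>The claim is \<open>Q 0 \<le> Q (b / 2)\<close>, and \<open>G\<close> is
    determined by \<open>Q' x = exp (2 * x) * (G x - 1)\<close>.\<close>
  define G where "G x = (1 + x + x\<^sup>2 / 3) * exp (x\<^sup>2 / 6 - x)" for x :: real
  define Q where "Q x = x * exp (x\<^sup>2 / 6 + x) - exp (2 * x) / 2" for x :: real
  have dG: "(G has_real_derivative x ^ 3 / 9 * exp (x\<^sup>2 / 6 - x)) (at x)" for x
    unfolding G_def by (auto intro!: derivative_eq_intros simp: field_simps power2_eq_square power3_eq_cube)
  have G: "1 \<le> G x" if "0 \<le> x" for x
  proof -
    have "G 0 \<le> G x"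
    proof (rule DERIV_nonneg_imp_nondecreasing[OF that])
      fix y assume "0 \<le> y" "y \<le> x"
      then show "\<exists>z. (G has_real_derivative z) (at y) \<and> 0 \<le> z"
        by (intro exI[of _ "y ^ 3 / 9 * exp (y\<^sup>2 / 6 - y)"] conjI dG) auto
    qed
    then show ?thesis by (simp add: G_def)
  qed
  have dQ: "(Q has_real_derivative exp (2 * x) * (G x - 1)) (at x)" for x
  proof -
    have "exp (x\<^sup>2 / 6 + x) = exp (2 * x) * exp (x\<^sup>2 / 6 - x)"
      by (simp flip: exp_add)
    then show ?thesis
      unfolding Q_def G_def
      by (auto intro!: derivative_eq_intros simp: field_simps power2_eq_square power3_eq_cube)
  qed
  have "Q 0 \<le> Q (b / 2)"
  proof (rule DERIV_nonneg_imp_nondecreasing[of 0 "b / 2" Q])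
    fix y assume "0 \<le> y" "y \<le> b / 2"
    then show "\<exists>z. (Q has_real_derivative z) (at y) \<and> 0 \<le> z"
      using G[of y] by (intro exI[of _ "exp (2 * y) * (G y - 1)"] conjI dQ) auto
  qed (use assms in simp)
  then show ?thesis
    by (simp add: Q_def power_divide field_simps)
qed

text \<open>Equality holds at 1, and the difference of the two sides is nonincreasing because
  \<open>27 * x \<le> (2 + x) ^ 3\<close>, the inequality of the means for \<open>x\<close>, 1,
  1.\<close>

lemma minus_ln_ge_rational:
  fixes t :: real
  assumes "0 < t" "t \<le> 1"
  shows "3/2 * (9 / (2 + t)\<^sup>2 - 1) \<le> - ln t"
proof -
  define G where "G x = - ln x - 27/2 / (2 + x)\<^sup>2" for x :: real
  have "G 1 \<le> G t"
  proof (rule DERIV_nonpos_imp_nonincreasing[OF assms(2)])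
    fix x :: real assume x: "t \<le> x" "x \<le> 1"
    have "27 * x \<le> (2 + x) ^ 3"
    proof -
      have "(2 + x) ^ 3 - 27 * x = (x - 1)\<^sup>2 * (x + 8)"
        by (simp add: power2_eq_square power3_eq_cube algebra_simps)
      moreover have "0 \<le> (x - 1)\<^sup>2 * (x + 8)" using x assms by simp
      ultimately show ?thesis by linarith
    qed
    then have "27 / (2 + x) ^ 3 - 1 / x \<le> 0"
      using x assms by (simp add: divide_simps mult_ac)
    moreover have "(G has_real_derivative 27 / (2 + x) ^ 3 - 1 / x) (at x)"
    proof -
      have "(G has_real_derivative - (1 / x) - (0 * (2 + x)\<^sup>2 - 27/2 * (2 * (2 + x))) / ((2 + x)\<^sup>2 * (2 + x)\<^sup>2)) (at x)"
        unfolding G_def by (rule derivative_eq_intros refl | use x assms in force)+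
      also have "- (1 / x) - (0 * (2 + x)\<^sup>2 - 27/2 * (2 * (2 + x))) / ((2 + x)\<^sup>2 * (2 + x)\<^sup>2) = 27 / (2 + x) ^ 3 - 1 / x"
      proof -
        have "y \<noteq> 0 \<Longrightarrow> - (1 / x) - (0 * y\<^sup>2 - 27/2 * (2 * y)) / (y\<^sup>2 * y\<^sup>2) = 27 / y ^ 3 - 1 / x" for y
          by (simp add: power2_eq_square power3_eq_cube)
        from this[of "2 + x"] show ?thesis using x assms by linarith
      qed
      finally show ?thesis .
    qed
    ultimately show "\<exists>y. (G has_real_derivative y) (at x) \<and> y \<le> 0" by blast
  qed
  then show ?thesis by (simp add: G_def)
qed

text \<open>The left side is one increment of the fraction in \<open>falling_ratio_le\<close>, with
  \<open>t = 1 - k / n\<close> and \<open>e = 1 / n\<close>. As a function of \<open>e\<close> it is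
  monotone, with the sign of \<open>1 - 4 * t\<close>: for \<open>t \<ge> 1 / 4\<close> it is at
  most its value at \<open>e = 0\<close>, for smaller \<open>t\<close> at most its value at
  \<open>e = t\<close>.\<close>

lemma minus_ln_ge_increment:
  fixes t e :: real
  assumes e: "0 < e" "e \<le> t" and t: "t \<le> 1"
  shows "3/2 * ((9 - 4 * e) / ((2 + t) * (2 + t - e)) - 1) \<le> - ln t"
proof (cases "1 / 4 \<le> t")
  case True
  have "(9 - 4 * e) * (2 + t) \<le> 9 * (2 + t - e)"
    using True e by (simp add: algebra_simps)
  then have "(9 - 4 * e) / ((2 + t) * (2 + t - e)) \<le> 9 / (2 + t)\<^sup>2"
    using e t by (simp add: divide_simps power2_eq_square mult_ac)
  moreover have "0 < t" using e by simp
  ultimately show ?thesis using minus_ln_ge_rational[OF \<open>0 < t\<close> t] by argo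
next
  case False
  have *: "(9 - 4 * e) * 2 \<le> (9 - 4 * t) * (2 + t - e)"
  proof -
    have "(9 - 4 * t) * (2 + t - e) - (9 - 4 * e) * 2 = (t - e) * (1 - 4 * t)"
      by (simp add: algebra_simps)
    moreover have "0 \<le> (t - e) * (1 - 4 * t)"
      using False e by (intro mult_nonneg_nonneg) auto
    ultimately show ?thesis by linarith
  qed
  have 1: "(9 - 4 * e) / ((2 + t) * (2 + t - e)) \<le> (9 - 4 * t) / (2 * (2 + t))"
  proof -
    have "(9 - 4 * e) / (2 + t - e) \<le> (9 - 4 * t) / 2"
      using * e t by (simp add: pos_divide_le_eq)
    then have "(9 - 4 * e) / (2 + t - e) / (2 + t) \<le> (9 - 4 * t) / 2 / (2 + t)"
      using e by (intro divide_right_mono) auto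
    then show ?thesis by (simp add: mult.commute)
  qed
  \<comment> \<open>Tangent of the logarithm at \<open>t = 1 / 4\<close>, the upper end of the
    remaining range.\<close>
  have "ln (4 * t) \<le> 4 * t - 1"
    using e by (intro ln_le_minus_one) simp
  moreover have "ln (4 * t) = 2 * ln 2 + ln t"
    using e ln_realpow[of 2 2] by (simp add: ln_mult)
  ultimately have 2: "7 / 3 - 4 * t \<le> - ln t"
    using ln2_ge_two_thirds by simp
  have "3/2 * ((9 - 4 * t) / (2 * (2 + t)) - 1) \<le> 7 / 3 - 4 * t"
  proof -
    have "t * t \<le> t * (1 / 4)" using False e by (intro mult_left_mono) auto
    moreover have "(28 / 3 - 16 * t) * (2 + t) = 56 / 3 - 68 / 3 * t - 16 * (t * t)"
      by (simp add: algebra_simps)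
    ultimately have "15 - 18 * t \<le> (28 / 3 - 16 * t) * (2 + t)"
      using False e by linarith
    then show ?thesis using e by (simp add: field_simps)
  qed
  with 1 2 show ?thesis by argo
qed

section \<open>Bounds for the falling factorial of n with k factors, divided by
  \<open>n ^ k\<close>\<close>

definition falling_ratio :: "nat \<Rightarrow> nat \<Rightarrow> real" where
  "falling_ratio n k = (\<Prod>i<k. 1 - real i / real n)"

lemma falling_ratio_pos: "k \<le> n \<Longrightarrow> 0 < falling_ratio n k"
  unfolding falling_ratio_def by (intro prod_pos) (auto simp: divide_simps)

text \<open>The exponent vanishes at \<open>k = 0\<close>, and \<open>minus_ln_ge_increment\<close>
  absorbs each new factor \<open>1 - k / n\<close>. Its form is dictated by
  \<open>falling_ratio_exp_le\<close>, where completing the square in \<open>b\<close> leaves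
  exactly this fraction.\<close>

lemma falling_ratio_le:
  assumes "k \<le> n" "0 < n"
  shows "falling_ratio n k \<le> exp (1 - 3 * (2 * n + (real k)\<^sup>2 - 2 * real k) / (2 * (3 * n - real k)))"
  using assms(1)
proof (induction k)
  case 0
  then show ?case using assms by (simp add: falling_ratio_def)
next
  case (Suc k)
  let ?R = "\<lambda>k. 3 * (2 * n + (real k)\<^sup>2 - 2 * real k) / (2 * (3 * n - real k))"
  define t where "t = 1 - real k / n"
  define e where "e = 1 / real n"
  have t: "e \<le> t" "0 < e" "t \<le> 1"
    using Suc.prems assms by (auto simp: t_def e_def field_simps)
  have v: "3 * n - real k = n * (2 + t)" "3 * n - real (Suc k) = n * (2 + t - e)"
    using assms by (auto simp: t_def e_def field_simps)
  have k: "real k = n * (1 - t)" "real n * e = 1" "real (Suc k) = n * (1 - t) + 1"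
    using assms by (auto simp: t_def e_def field_simps)
  have "?R (Suc k) - ?R k = 3/2 * ((9 - 4 * e) / ((2 + t) * (2 + t - e)) - 1)"
  proof -
    have n0: "real n \<noteq> 0" using assms by simp
    have p: "2 + t \<noteq> 0" "2 + t - e \<noteq> 0" "2 + t > 0" "2 + t - e > 0" using t by auto
    have 1: "?R k = 3 / 2 * (n * (1 - t)\<^sup>2 - 2 * (1 - t) + 2) / (2 + t)"
    proof -
      have "2 * n + (real k)\<^sup>2 - 2 * real k = n * (n * (1 - t)\<^sup>2 - 2 * (1 - t) + 2)"
        unfolding k(1) by (simp add: power2_eq_square algebra_simps)
      then show ?thesis unfolding v(1) using n0 by simp
    qed
    have 2: "?R (Suc k) = 3 / 2 * (n * (1 - t + e)\<^sup>2 - 2 * (1 - t + e) + 2) / (2 + t - e)"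
    proof -
      have "real (Suc k) = n * (1 - t + e)" using k(2,3) by (simp add: algebra_simps)
      then have "2 * n + (real (Suc k))\<^sup>2 - 2 * real (Suc k) = n * (n * (1 - t + e)\<^sup>2 - 2 * (1 - t + e) + 2)"
        by (simp only:) (simp add: power2_eq_square algebra_simps)
      then show ?thesis unfolding v(2) using n0 by (simp del: of_nat_Suc)
    qed
    \<comment> \<open>Eliminating \<open>n\<close> leaves a rational identity in \<open>t\<close>
      and \<open>e\<close>.\<close>
    have e': "real n = 1 / e" using t k(2) by (simp add: field_simps)
    show ?thesis unfolding 1 2 e' using p t
      by (simp add: divide_simps) (simp add: power2_eq_square algebra_simps)
  qed
  also have "\<dots> \<le> - ln t"
    using t by (intro minus_ln_ge_increment)
  finally have "t \<le> exp (?R k - ?R (Suc k))"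
    using t by (subst ln_le_cancel_iff[symmetric]) auto
  then have "falling_ratio n k * t \<le> exp (1 - ?R k) * exp (?R k - ?R (Suc k))"
    using Suc t falling_ratio_pos[of k n] by (intro mult_mono) auto
  then show ?case
    by (simp add: falling_ratio_def t_def flip: exp_add)
qed

text \<open>The quadratic in \<open>b\<close> that remains after bounding both factors by exponentials is maximal at
  \<open>b = 6 (k + X) / (3 n - k)\<close>, where the hypothesis on \<open>X\<close> suffices.\<close>

lemma falling_ratio_exp_le:
  fixes b X :: real
  assumes "k \<le> n" "0 < n" "0 < b" "X * (X + 2 * k) \<le> 2 * (n - real k)"
  shows "exp (b * X / 2 - 1) * (falling_ratio n k * ((exp b - 1) / b) ^ k) \<le> exp (n * b\<^sup>2 / 8)"
proof -
  define v where "v = 3 * n - real k"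
  have v: "0 < v" using assms by (simp add: v_def)
  have "((exp b - 1) / b) ^ k \<le> exp (b / 2 + b\<^sup>2 / 24) ^ k"
    using exp_minus_1_le[of b] assms by (intro power_mono) (auto simp: divide_simps mult_ac)
  then have "exp (b * X / 2 - 1) * (falling_ratio n k * ((exp b - 1) / b) ^ k) \<le>
     exp (b * X / 2 - 1) * (exp (1 - 3 * (2 * n + (real k)\<^sup>2 - 2 * real k) / (2 * v)) * exp (b / 2 + b\<^sup>2 / 24) ^ k)"
    using falling_ratio_le[OF assms(1,2)] assms falling_ratio_pos[OF assms(1)]
    by (intro mult_left_mono mult_mono) (auto simp: v_def)
  also have "\<dots> = exp (b * (k + X) / 2 + k * b\<^sup>2 / 24 - 3 * (2 * n + (real k)\<^sup>2 - 2 * real k) / (2 * v))"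
    by (simp add: algebra_simps add_divide_distrib flip: exp_add exp_of_nat_mult)
  also have "b * (k + X) / 2 + k * b\<^sup>2 / 24 - 3 * (2 * n + (real k)\<^sup>2 - 2 * real k) / (2 * v) \<le> n * b\<^sup>2 / 8"
  proof -
    have "(k + X)\<^sup>2 \<le> 2 * n + (real k)\<^sup>2 - 2 * real k"
      using assms(4) by (simp add: power2_eq_square algebra_simps)
    then have "3 * (k + X)\<^sup>2 / (2 * v) \<le> 3 * (2 * n + (real k)\<^sup>2 - 2 * real k) / (2 * v)"
      using v by (simp add: divide_simps)
    moreover have "b * (k + X) / 2 \<le> b\<^sup>2 * v / 24 + 3 * (k + X)\<^sup>2 / (2 * v)"
    proof -
      have "0 \<le> (b * v - 6 * (k + X))\<^sup>2 / (24 * v)" using v by simp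
      also have "\<dots> = b\<^sup>2 * v / 24 + 3 * (k + X)\<^sup>2 / (2 * v) - b * (k + X) / 2"
        using v by (simp add: field_simps power2_eq_square)
      finally show ?thesis by simp
    qed
    moreover have "b\<^sup>2 * v / 24 + k * b\<^sup>2 / 24 = n * b\<^sup>2 / 8"
      by (simp add: v_def field_simps)
    ultimately show ?thesis by linarith
  qed
  finally show ?thesis by simp
qed

section \<open>The integrated crossing bound\<close>

lemma slide_sum:
  assumes "finite K" "\<And>k a b. k \<in> K \<Longrightarrow> f k integrable_on {a..b}"
  shows "slide (\<lambda>y. \<Sum>k\<in>K. f k y * C k) y = (\<Sum>k\<in>K. slide (f k) y * C k)"
  unfolding slide_def using assms
  by (subst Henstock_Kurzweil_Integration.integral_sum)
    (auto intro!: integrable_on_mult_left sum.cong)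

lemma crossing_poly_integrable: "crossing_poly j b integrable_on {u..v}"
  unfolding crossing_poly_def[abs_def]
  by (intro integrable_sum finite_atMost integrable_on_mult_left passage_integrable)

lemma crossing_poly_Suc:
  assumes "0 < y"
  shows "crossing_poly (Suc j) b y = slide (crossing_poly j b) y"
proof -
  have "slide (crossing_poly j b) y = (\<Sum>k\<le>j. slide (passage k) y * (b ^ (j - k) / fact (j - k)))"
    unfolding crossing_poly_def[abs_def] by (rule slide_sum) (auto intro: passage_integrable)
  then show ?thesis using assms by (simp add: crossing_poly_Suc_pos)
qed

lemma passage_eq_0: "real k < y \<Longrightarrow> passage k y = 0"
proof (induction k arbitrary: y)
  case (Suc k)
  then have "slide (passage k) y = integral {y - 1..y} (\<lambda>_. 0)"
    unfolding slide_def by (intro Henstock_Kurzweil_Integration.integral_cong) auto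
  then show ?case by simp
qed auto

text \<open>The coefficient of \<open>passage k y\<close> is the falling factorial of
  \<open>j\<close> with \<open>k\<close> factors over \<open>n ^ k\<close>, so for
  \<open>j = n\<close> this is the expectation of \<open>falling_ratio n \<tau>\<close>. Smaller
  \<open>j\<close> serve the recursion, which keeps \<open>n\<close> fixed.\<close>

definition crossing_bound :: "nat \<Rightarrow> nat \<Rightarrow> real \<Rightarrow> real" where
  "crossing_bound n j y = fact j / real n ^ j * crossing_poly j n y"

lemma crossing_bound_nonpos: "0 < n \<Longrightarrow> y \<le> 0 \<Longrightarrow> crossing_bound n j y = 1"
  by (simp add: crossing_bound_def crossing_poly_nonpos)

lemma crossing_bound_eq_0: "real j < y \<Longrightarrow> crossing_bound n j y = 0"
  by (auto simp: crossing_bound_def crossing_poly_def passage_eq_0 intro!: sum.neutral)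

lemma crossing_bound_integrable: "crossing_bound n j integrable_on {u..v}"
  unfolding crossing_bound_def[abs_def] using integrable_on_cmult_left[OF crossing_poly_integrable, of "fact j / real n ^ j" j "real n" u v] by simp

lemma crossing_bound_Suc:
  assumes "0 < y"
  shows "crossing_bound n (Suc j) y = real (Suc j) / n * slide (crossing_bound n j) y"
  unfolding crossing_bound_def[abs_def] crossing_poly_Suc[OF assms] slide_def by (simp add: field_simps)

text \<open>The upper limit stands for infinity, since for \<open>j \<le> n\<close> the integrand
  vanishes above \<open>n\<close>. The margin 2 leaves room for the unit window of
  \<open>slide\<close> and for neighbourhoods of points up to \<open>n\<close>.\<close>

definition crossing_tail :: "nat \<Rightarrow> nat \<Rightarrow> real \<Rightarrow> real" where
  "crossing_tail n j a = integral {a..real n + 2} (crossing_bound n j)"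

section \<open>Recursion and exponential bound for the integrated tail\<close>

context
  fixes n :: nat
  assumes n: "0 < n"
begin

lemma crossing_tail_eq_0:
  assumes "j \<le> n" "real n < a"
  shows "crossing_tail n j a = 0"
proof -
  have "crossing_tail n j a = integral {a..real n + 2} (\<lambda>_. 0)"
    unfolding crossing_tail_def using assms
    by (intro Henstock_Kurzweil_Integration.integral_cong crossing_bound_eq_0) auto
  then show ?thesis by simp
qed

lemma crossing_tail_diff:
  assumes "a \<le> a'" "a' \<le> real n + 2"
  shows "crossing_tail n j a - crossing_tail n j a' = integral {a..a'} (crossing_bound n j)"
  using Henstock_Kurzweil_Integration.integral_combine[OF assms crossing_bound_integrable, of n j]
  by (simp add: crossing_tail_def)

lemma isCont_crossing_tail:
  assumes "j \<le> n"
  shows "isCont (crossing_tail n j) a"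
proof (cases "a > n")
  case True
  have "\<forall>\<^sub>F u in nhds a. crossing_tail n j u = 0"
    by (rule eventually_nhds_in_open[of "{real n<..}", THEN eventually_mono])
      (use True assms in \<open>auto intro: crossing_tail_eq_0\<close>)
  then show ?thesis by (subst isCont_cong) auto
next
  case False
  let ?I = "\<lambda>u. integral {a - 1..u} (crossing_bound n j)"
  have eq: "crossing_tail n j u = crossing_tail n j (a - 1) - ?I u" if "a - 1 < u" "u < real n + 2" for u
    using crossing_tail_diff[of "a - 1" u j] that by simp
  have "continuous_on {a - 1..real n + 2} ?I"
    by (rule indefinite_integral_continuous_1[OF crossing_bound_integrable])
  then have "isCont ?I a"
    using False by (intro continuous_on_interior[of "{a - 1..real n + 2}"]) auto
  then have "isCont (\<lambda>u. crossing_tail n j (a - 1) - ?I u) a"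
    by (intro continuous_intros)
  moreover have "\<forall>\<^sub>F u in nhds a. crossing_tail n j u = crossing_tail n j (a - 1) - ?I u"
    by (rule eventually_nhds_in_open[of "{a - 1<..<real n + 2}", THEN eventually_mono])
      (use False eq in auto)
  ultimately show ?thesis by (subst isCont_cong) auto
qed

lemma crossing_tail_integrable: "j \<le> n \<Longrightarrow> crossing_tail n j integrable_on {u..v}"
  by (intro integrable_continuous_real continuous_at_imp_continuous_on ballI isCont_crossing_tail)

text \<open>\<open>slide\<close> commutes with taking tails, so the recursion
  \<open>crossing_bound_Suc\<close>, valid for positive arguments, can be integrated from any
  \<open>a \<ge> 0\<close>.\<close>

lemma crossing_tail_Suc:
  assumes "Suc j \<le> n" "0 \<le> a" "a \<le> real n + 2"
  shows "crossing_tail n (Suc j) a = real (Suc j) / n * slide (crossing_tail n j) a"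
proof -
  have j: "j \<le> n" using assms by simp
  have "((\<lambda>x. - slide (crossing_bound n j) x) has_integral (slide (crossing_tail n j) (real n + 2) - slide (crossing_tail n j) a)) {a..real n + 2}"
  proof (rule fundamental_theorem_of_calculus_interior)
    show "(slide (crossing_tail n j) has_vector_derivative - slide (crossing_bound n j) x) (at x)"
      if "x \<in> {a<..<real n + 2}" for x
    proof -
      have "(slide (crossing_tail n j) has_real_derivative crossing_tail n j x - crossing_tail n j (x - 1)) (at x)"
        by (intro DERIV_slide crossing_tail_integrable isCont_crossing_tail j)
      moreover have "crossing_tail n j x - crossing_tail n j (x - 1) = - slide (crossing_bound n j) x"
        using crossing_tail_diff[of "x - 1" x j] that by (simp add: slide_def)
      ultimately show ?thesis by (simp add: has_real_derivative_iff_has_vector_derivative)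
    qed
    show "continuous_on {a..real n + 2} (slide (crossing_tail n j))"
      by (intro continuous_at_imp_continuous_on ballI isCont_slide crossing_tail_integrable j)
  qed (use assms in auto)
  then have 1: "((\<lambda>x. slide (crossing_bound n j) x) has_integral (slide (crossing_tail n j) a - slide (crossing_tail n j) (real n + 2))) {a..real n + 2}"
    by (drule_tac has_integral_neg) simp
  have "slide (crossing_tail n j) (real n + 2) = integral {real n + 2 - 1..real n + 2} (\<lambda>_. 0)"
    unfolding slide_def using j
    by (intro Henstock_Kurzweil_Integration.integral_cong crossing_tail_eq_0) auto
  with 1 have 1: "((\<lambda>x. slide (crossing_bound n j) x) has_integral slide (crossing_tail n j) a) {a..real n + 2}"
    by simp
  have "(crossing_bound n (Suc j) has_integral (real (Suc j) / n * slide (crossing_tail n j) a)) {a..real n + 2}"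
    \<comment> \<open>The recursion may fail at the single point 0.\<close>
    by (rule has_integral_spike_finite[OF _ _ has_integral_mult_right[OF 1], of "{0}"])
      (use assms in \<open>auto simp: crossing_bound_Suc\<close>)
  then show ?thesis
    unfolding crossing_tail_def by (simp add: integral_unique)
qed

lemma crossing_tail_nonpos:
  assumes "a \<le> 0"
  shows "crossing_tail n j a = crossing_tail n j 0 - a"
proof -
  have "integral {a..0} (crossing_bound n j) = integral {a..0} (\<lambda>_. 1)"
    by (intro Henstock_Kurzweil_Integration.integral_cong) (auto simp: crossing_bound_nonpos n)
  then show ?thesis using crossing_tail_diff[of a 0 j] assms by simp
qed

lemma crossing_tail_0_pos: "0 \<le> a \<Longrightarrow> crossing_tail n 0 a = 0"
  unfolding crossing_tail_def
  by (rule integral_unique, rule has_integral_spike_finite[OF _ _ has_integral_0, of "{0}"])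
    (auto simp: crossing_bound_def crossing_poly_def)

text \<open>On the window [-1, 0] the tail is the affine function \<open>T - y\<close>, whose mean
  is \<open>T + 1 / 2\<close>.\<close>

lemma crossing_tail_Suc_0:
  assumes "Suc j \<le> n"
  shows "crossing_tail n (Suc j) 0 = real (Suc j) / n * (crossing_tail n j 0 + 1 / 2)"
proof -
  define T where "T = crossing_tail n j 0"
  have "slide (crossing_tail n j) 0 = integral {-1..0} (\<lambda>y. T - y)"
    unfolding slide_def T_def diff_0
    by (intro Henstock_Kurzweil_Integration.integral_cong crossing_tail_nonpos) auto
  also have "\<dots> = T + 1 / 2"
  proof (rule integral_unique)
    have "((\<lambda>y. T - y) has_integral ((T * 0 - 0\<^sup>2 / 2) - (T * (-1) - (-1)\<^sup>2 / 2))) {-1..0}"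
      by (rule fundamental_theorem_of_calculus)
        (auto intro!: derivative_eq_intros simp flip: has_real_derivative_iff_has_vector_derivative)
    then show "((\<lambda>y. T - y) has_integral (T + 1 / 2)) {-1..0}" by (simp add: add.commute)
  qed
  finally show ?thesis using crossing_tail_Suc[OF assms, of 0] by (simp add: T_def)
qed

text \<open>With \<open>X = 2 * crossing_tail n j 0\<close> and \<open>k = n - j\<close> this is the
  hypothesis on \<open>X\<close> in \<open>falling_ratio_exp_le\<close>. The recursion maps
  \<open>x\<close> to \<open>s * (x + 1)\<close> with \<open>s = (j + 1) / n\<close>, and bounding
  one of the two factors \<open>s\<close> by 1 suffices.\<close>

lemma crossing_tail_0_bounds:
  assumes "j \<le> n"
  shows "0 \<le> crossing_tail n j 0 \<and> (2 * crossing_tail n j 0) * (2 * crossing_tail n j 0 + 2 * (real n - j)) \<le> 2 * j"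
  using assms
proof (induction j)
  case 0
  then show ?case by (simp add: crossing_tail_0_pos)
next
  case (Suc j)
  define x where "x = 2 * crossing_tail n j 0"
  define k where "k = real n - real (Suc j)"
  define s where "s = real (Suc j) / n"
  have x: "0 \<le> x" "x * (x + 2 * (k + 1)) \<le> 2 * j" "0 \<le> k"
    using Suc by (auto simp: x_def k_def)
  have s: "0 \<le> s" "s \<le> 1" using Suc.prems n by (auto simp: s_def divide_simps)
  have eq: "2 * crossing_tail n (Suc j) 0 = s * (x + 1)"
    unfolding crossing_tail_Suc_0[OF Suc.prems] s_def[symmetric] x_def by (simp add: algebra_simps)
  have "s * (x + 1) * (s * (x + 1) + 2 * k) = s * (s * (x + 1)\<^sup>2 + 2 * k * (x + 1))"
    by (simp add: power2_eq_square algebra_simps)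
  also have "\<dots> \<le> s * (2 * n)"
  proof (rule mult_left_mono)
    have "s * (x + 1)\<^sup>2 \<le> 1 * (x + 1)\<^sup>2" using s by (intro mult_right_mono) auto
    then show "s * (x + 1)\<^sup>2 + 2 * k * (x + 1) \<le> 2 * n"
      using x by (simp add: k_def power2_eq_square algebra_simps)
  qed (use s in simp)
  also have "\<dots> = 2 * real (Suc j)" using n by (simp add: s_def)
  finally have "s * (x + 1) * (s * (x + 1) + 2 * k) \<le> 2 * real (Suc j)" .
  moreover have "0 \<le> s * (x + 1)" using x s by simp
  ultimately show ?case unfolding eq[symmetric] k_def by simp
qed

text \<open>For \<open>a \<le> 0\<close> the tail is \<open>T - a\<close>; the inequality
  \<open>u \<le> exp (u - 1)\<close> at \<open>u = b * (T - a)\<close> makes it exponential in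
  \<open>a\<close>, and \<open>falling_ratio_exp_le\<close> with \<open>X = 2 * T\<close> compares
  the constants.\<close>

lemma crossing_tail_le_exp_nonpos:
  fixes b :: real
  assumes "j \<le> n" "0 < b" "a \<le> 0"
  shows "crossing_tail n j a \<le> exp (n * b\<^sup>2 / 8) / b / (falling_ratio n (n - j) * ((exp b - 1) / b) ^ (n - j)) * exp (- b * a)"
proof -
  define P where "P = falling_ratio n (n - j) * ((exp b - 1) / b) ^ (n - j)"
  define T where "T = crossing_tail n j 0"
  have P: "0 < P"
    using falling_ratio_pos[of "n - j" n] assms by (auto simp: P_def)
  have "exp (b * (2 * T) / 2 - 1) * P \<le> exp (n * b\<^sup>2 / 8)"
    unfolding P_def T_def using crossing_tail_0_bounds[OF assms(1)] assms n
    by (intro falling_ratio_exp_le) (auto simp: of_nat_diff)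
  then have 1: "exp (b * T - 1) / b \<le> exp (n * b\<^sup>2 / 8) / b / P"
    using P assms by (simp add: field_simps)
  have "crossing_tail n j a = (1 + (b * T - 1 - b * a)) / b"
    using crossing_tail_nonpos[OF assms(3), of j] assms by (simp add: T_def flip: right_diff_distrib)
  also have "\<dots> \<le> exp (b * T - 1 - b * a) / b"
    using assms by (intro divide_right_mono exp_ge_add_one_self) auto
  also have "\<dots> = exp (b * T - 1) / b * exp (- b * a)"
    by (simp flip: exp_add)
  also have "\<dots> \<le> exp (n * b\<^sup>2 / 8) / b / P * exp (- b * a)"
    by (intro mult_right_mono 1) auto
  finally show ?thesis by (simp add: P_def)
qed

text \<open>Exponentials are eigenfunctions of \<open>slide\<close>, so an exponential majorant
  passes through the recursion of \<open>crossing_tail\<close>.\<close>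

lemma exp_has_integral_slide:
  fixes b :: real
  assumes "b \<noteq> 0"
  shows "((\<lambda>y. exp (- b * y)) has_integral (exp b - 1) / b * exp (- b * a)) {a - 1..a}"
proof -
  have "((\<lambda>y. exp (- b * y)) has_integral (- exp (- b * a) / b - (- exp (- b * (a - 1)) / b))) {a - 1..a}"
    by (rule fundamental_theorem_of_calculus)
      (auto intro!: derivative_eq_intros simp: assms simp flip: has_real_derivative_iff_has_vector_derivative)
  also have "- exp (- b * a) / b - (- exp (- b * (a - 1)) / b) = (exp b - 1) / b * exp (- b * a)"
    using assms by (simp add: field_simps flip: exp_add)
  finally show ?thesis .
qed

text \<open>With \<open>k = n - Suc j\<close>, one step of the recursion multiplies by
  \<open>1 - k / n\<close> and by the eigenvalue of \<open>slide\<close>. This cancels one factor of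
  each kind in the denominator, which is 1 when \<open>j = n\<close>. For \<open>a \<le> 0\<close>
  the previous affine case applies at every \<open>j\<close>.\<close>

lemma crossing_tail_le_exp_aux:
  fixes b :: real
  assumes "j \<le> n" "0 < b" "a \<le> real n + 2"
  shows "crossing_tail n j a \<le> exp (n * b\<^sup>2 / 8) / b / (falling_ratio n (n - j) * ((exp b - 1) / b) ^ (n - j)) * exp (- b * a)"
  using assms(1,3)
proof (induction j arbitrary: a)
  case 0
  show ?case
  proof (cases "a \<le> 0")
    case False
    have "0 < falling_ratio n n" by (rule falling_ratio_pos) simp
    then show ?thesis using False assms(2) by (auto simp: crossing_tail_0_pos intro!: mult_nonneg_nonneg divide_nonneg_nonneg)
  qed (use crossing_tail_le_exp_nonpos[of 0 b a] assms in auto)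
next
  case (Suc j)
  show ?case
  proof (cases "a \<le> 0")
    case False
    define e where "e = (exp b - 1) / b"
    define k where "k = n - Suc j"
    have k: "n - j = Suc k" "Suc k \<le> n" using Suc.prems by (auto simp: k_def)
    define C where "C = exp (n * b\<^sup>2 / 8) / b / (falling_ratio n (Suc k) * e ^ Suc k)"
    have e: "0 < e" using assms by (simp add: e_def)
    have "slide (crossing_tail n j) a \<le> C * (e * exp (- b * a))"
      unfolding slide_def
    proof (rule has_integral_le)
      show "(crossing_tail n j has_integral integral {a - 1..a} (crossing_tail n j)) {a - 1..a}"
        using Suc.prems by (intro integrable_integral crossing_tail_integrable) auto
      show "((\<lambda>y. C * exp (- b * y)) has_integral C * (e * exp (- b * a))) {a - 1..a}"
        using exp_has_integral_slide[of b a] assms unfolding e_def by (intro has_integral_mult_right) auto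
      show "crossing_tail n j y \<le> C * exp (- b * y)" if "y \<in> {a - 1..a}" for y
        using Suc.IH[of y] Suc.prems that k by (simp add: C_def e_def)
    qed
    then have "crossing_tail n (Suc j) a \<le> real (Suc j) / n * (C * (e * exp (- b * a)))"
      using Suc.prems False by (subst crossing_tail_Suc) (auto intro!: mult_left_mono simp del: of_nat_Suc times_divide_eq_left)
    also have "real (Suc j) / n = 1 - real k / n"
      using Suc.prems n by (simp add: k_def field_simps of_nat_diff)
    also have "(1 - real k / n) * (C * (e * exp (- b * a))) = exp (n * b\<^sup>2 / 8) / b / (falling_ratio n k * e ^ k) * exp (- b * a)"
    proof -
      define s where "s = 1 - real k / n"
      have "falling_ratio n (Suc k) = falling_ratio n k * s" by (simp add: falling_ratio_def s_def)
      moreover have "falling_ratio n (Suc k) \<noteq> 0" using falling_ratio_pos[OF k(2)] by simp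
      ultimately show ?thesis
        unfolding s_def[symmetric] C_def using e by (simp add: field_simps)
    qed
    finally show ?thesis by (simp add: k_def e_def)
  qed (use crossing_tail_le_exp_nonpos[of "Suc j" b a] assms Suc.prems in auto)
qed

lemma crossing_tail_le_exp:
  fixes b :: real
  assumes "0 < b" "a \<le> real n + 2"
  shows "crossing_tail n n a \<le> exp (n * b\<^sup>2 / 8 - b * a) / b"
proof -
  have "crossing_tail n n a \<le> exp (n * b\<^sup>2 / 8) / b * exp (- b * a)"
    using crossing_tail_le_exp_aux[OF order_refl assms] by (simp add: falling_ratio_def)
  also have "\<dots> = exp (n * b\<^sup>2 / 8 - b * a) / b"
    by (simp flip: exp_add)
  finally show ?thesis .
qed

end

section \<open>Identically distributed variables on finitely many cells\<close>

lemma sum_Pow_card: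
  fixes f :: "nat \<Rightarrow> real"
  assumes "finite A"
  shows "(\<Sum>B\<in>Pow A. f (card B)) = (\<Sum>i\<le>card A. real (card A choose i) * f i)"
proof -
  have "(\<Sum>B\<in>Pow A. f (card B)) = (\<Sum>i\<le>card A. \<Sum>B\<in>{B \<in> Pow A. card B = i}. f (card B))"
    using assms by (intro sum.group[symmetric]) (auto intro: card_mono)
  also have "\<dots> = (\<Sum>i\<le>card A. real (card A choose i) * f i)"
  proof (intro sum.cong refl)
    fix i
    have "(\<Sum>B\<in>{B \<in> Pow A. card B = i}. f (card B)) = (\<Sum>B\<in>{B \<in> Pow A. card B = i}. f i)"
      by (intro sum.cong) auto
    also have "\<dots> = real (card A choose i) * f i"
      using n_subsets[OF assms, of i] by (simp add: Pow_def)
    finally show "(\<Sum>B\<in>{B \<in> Pow A. card B = i}. f (card B)) = real (card A choose i) * f i" .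
  qed
  finally show ?thesis .
qed

text \<open>In \<open>iid_crossing_le\<close>, \<open>d\<close> is the weight of the last cell and
  \<open>i\<close> the number of variables outside it.\<close>

lemma crossing_poly_add_binomial:
  "fact j * crossing_poly j (b + d) y = (\<Sum>i\<le>j. real (j choose i) * (d ^ (j - i) * (fact i * crossing_poly i b y)))"
proof -
  have "fact j * crossing_poly j (b + d) y = (\<Sum>i\<le>j. fact j * ((d ^ i / fact i) * crossing_poly (j - i) b y))"
    by (simp add: crossing_poly_add sum_distrib_left)
  also have "\<dots> = (\<Sum>i\<le>j. fact j * ((d ^ (j - i) / fact (j - i)) * crossing_poly i b y))"
    by (rule sum.reindex_bij_witness[of _ "\<lambda>i. j - i" "\<lambda>i. j - i"]) auto
  also have "\<dots> = (\<Sum>i\<le>j. real (j choose i) * (d ^ (j - i) * (fact i * crossing_poly i b y)))"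
    by (intro sum.cong refl) (simp add: binomial_fact)
  finally show ?thesis .
qed

text \<open>\<open>B\<close> collects the indices whose cell is below \<open>l\<close>; all others
  sit in the last cell.\<close>

lemma sum_PiE_lessThan_Suc:
  fixes g :: "('i \<Rightarrow> nat) \<Rightarrow> real"
  assumes "finite A"
  shows "(\<Sum>x\<in>A \<rightarrow>\<^sub>E {..<Suc l}. g x) =
    (\<Sum>B\<in>Pow A. \<Sum>x\<in>B \<rightarrow>\<^sub>E {..<l}. g (\<lambda>i\<in>A. if i \<in> B then x i else l))"
proof -
  have "(\<Sum>B\<in>Pow A. \<Sum>x\<in>B \<rightarrow>\<^sub>E {..<l}. g (\<lambda>i\<in>A. if i \<in> B then x i else l)) =
    (\<Sum>(B, x)\<in>(SIGMA B:Pow A. B \<rightarrow>\<^sub>E {..<l}). g (\<lambda>i\<in>A. if i \<in> B then x i else l))"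
    using assms by (intro sum.Sigma) (auto intro!: finite_PiE dest: finite_subset)
  also have "\<dots> = (\<Sum>x\<in>A \<rightarrow>\<^sub>E {..<Suc l}. g x)"
  proof (rule sum.reindex_bij_witness[where
        i = "\<lambda>x. ({i \<in> A. x i < l}, restrict x {i \<in> A. x i < l})" and
        j = "\<lambda>(B, x). \<lambda>i\<in>A. if i \<in> B then x i else l"], goal_cases)
    case (1 a)
    obtain B x where a: "a = (B, x)" by force
    with 1 have B: "B \<subseteq> A" "x \<in> B \<rightarrow>\<^sub>E {..<l}" by auto
    have "{i \<in> A. (\<lambda>i\<in>A. if i \<in> B then x i else l) i < l} = B"
      using B by (auto split: if_splits)
    moreover have "restrict (\<lambda>i\<in>A. if i \<in> B then x i else l) B = x"
      using B by (auto intro!: ext simp: restrict_def PiE_def extensional_def)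
    ultimately show ?case by (simp add: a)
  next
    case (3 x)
    have eq: "l = x i" if "i \<in> A" "\<not> x i < l" for i using PiE_mem[OF 3 that(1)] that by auto
    show ?case using 3
      by (auto intro!: ext eq simp: restrict_def PiE_def extensional_def)
  next
    case (2 a)
    then show ?case by (auto split: if_splits simp: less_Suc_eq)
  next
    case (4 x)
    then show ?case by auto
  next
    case (5 a)
    then show ?case by auto
  qed
  finally show ?thesis by simp
qed

lemma ex_less_Suc_iff: "(\<exists>l<Suc L. P l) \<longleftrightarrow> P L \<or> (\<exists>l<L. P l)"
  by (auto simp: less_Suc_eq)

text \<open>The weights \<delta> are at once unnormalised masses and increments of the boundary.
  Induction removes the last cell. If \<open>card A\<close> reaches the last level, the event is
  bounded by the whole space and \<open>crossing_poly_ge_power\<close> bounds its mass. Otherwise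
  that level is never crossed, the event depends only on the variables in earlier cells, and the
  induction hypotheses for all subsets add up by \<open>crossing_poly_add_binomial\<close>.\<close>

lemma iid_crossing_le:
  fixes \<delta> :: "nat \<Rightarrow> real"
  assumes "\<And>l. 0 \<le> \<delta> l" "0 < y" "finite A"
  shows "(\<Sum>x\<in>A \<rightarrow>\<^sub>E {..<L}. (\<Prod>i\<in>A. \<delta> (x i)) *
      of_bool (\<exists>l<L. y + (\<Sum>l'\<le>l. \<delta> l') \<le> card {i \<in> A. x i \<le> l}))
    \<le> fact (card A) * crossing_poly (card A) (\<Sum>l<L. \<delta> l) y"
  using assms(3)
proof (induction L arbitrary: A)
  case 0
  then show ?case
    by (auto simp: crossing_poly_nonneg intro!: mult_nonneg_nonneg)
next
  case (Suc L)
  define b where "b = (\<Sum>l<L. \<delta> l)"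
  have b: "0 \<le> b" by (simp add: b_def sum_nonneg assms)
  show ?case
  proof (cases "y + (b + \<delta> L) \<le> card A")
    case True
    have "(\<Sum>x\<in>A \<rightarrow>\<^sub>E {..<Suc L}. (\<Prod>i\<in>A. \<delta> (x i)) *
      of_bool (\<exists>l<Suc L. y + (\<Sum>l'\<le>l. \<delta> l') \<le> card {i \<in> A. x i \<le> l}))
      \<le> (\<Sum>x\<in>A \<rightarrow>\<^sub>E {..<Suc L}. (\<Prod>i\<in>A. \<delta> (x i)))"
      by (intro sum_mono) (auto simp: prod_nonneg assms)
    also have "\<dots> = (b + \<delta> L) ^ card A"
      using Suc.prems by (subst prod_sum_PiE[symmetric]) (auto simp: b_def)
    also have "\<dots> \<le> fact (card A) * crossing_poly (card A) (b + \<delta> L) y"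
      using crossing_poly_ge_power[of "b + \<delta> L" "card A" y] True b assms(1)[of L]
      by (simp add: field_simps)
    finally show ?thesis by (simp add: b_def)
  next
    case False
    have "(\<Sum>x\<in>A \<rightarrow>\<^sub>E {..<Suc L}. (\<Prod>i\<in>A. \<delta> (x i)) *
      of_bool (\<exists>l<Suc L. y + (\<Sum>l'\<le>l. \<delta> l') \<le> card {i \<in> A. x i \<le> l}))
      = (\<Sum>B\<in>Pow A. \<Sum>x\<in>B \<rightarrow>\<^sub>E {..<L}. \<delta> L ^ (card A - card B) * ((\<Prod>i\<in>B. \<delta> (x i)) *
          of_bool (\<exists>l<L. y + (\<Sum>l'\<le>l. \<delta> l') \<le> card {i \<in> B. x i \<le> l})))"
      unfolding sum_PiE_lessThan_Suc[OF Suc.prems]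
    proof (intro sum.cong refl)
      fix B x assume B: "B \<in> Pow A" and x: "x \<in> B \<rightarrow>\<^sub>E {..<L}"
      let ?x = "\<lambda>i\<in>A. if i \<in> B then x i else L"
      have fB: "finite B" using B Suc.prems finite_subset by auto
      have "(\<Prod>i\<in>A. \<delta> (?x i)) = (\<Prod>i\<in>A - B. \<delta> (?x i)) * (\<Prod>i\<in>B. \<delta> (?x i))"
        using B Suc.prems by (intro prod.subset_diff) auto
      also have "(\<Prod>i\<in>A - B. \<delta> (?x i)) = \<delta> L ^ (card A - card B)"
        using B fB by (simp add: card_Diff_subset)
      also have "(\<Prod>i\<in>B. \<delta> (?x i)) = (\<Prod>i\<in>B. \<delta> (x i))"
        using B by (intro prod.cong) auto
      finally have 1: "(\<Prod>i\<in>A. \<delta> (?x i)) = \<delta> L ^ (card A - card B) * (\<Prod>i\<in>B. \<delta> (x i))" .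
      have 4: "{i \<in> A. ?x i \<le> l} = {i \<in> B. x i \<le> l}" if "l < L" for l
        using B that by auto
      have 3: "\<not> y + (\<Sum>l'\<le>L. \<delta> l') \<le> card {i \<in> A. ?x i \<le> L}"
      proof -
        have "card {i \<in> A. ?x i \<le> L} \<le> card A"
          using Suc.prems by (intro card_mono) auto
        moreover have "(\<Sum>l'\<le>L. \<delta> l') = b + \<delta> L"
          by (simp add: b_def flip: lessThan_Suc_atMost)
        ultimately show ?thesis using False by simp
      qed
      have 2: "(\<exists>l<Suc L. y + (\<Sum>l'\<le>l. \<delta> l') \<le> card {i \<in> A. ?x i \<le> l}) \<longleftrightarrow>
         (\<exists>l<L. y + (\<Sum>l'\<le>l. \<delta> l') \<le> card {i \<in> B. x i \<le> l})"
        using 3 4 unfolding ex_less_Suc_iff by (simp cong: conj_cong del: restrict_apply)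
      show "(\<Prod>i\<in>A. \<delta> (?x i)) * of_bool (\<exists>l<Suc L. y + (\<Sum>l'\<le>l. \<delta> l') \<le> card {i \<in> A. ?x i \<le> l}) =
        \<delta> L ^ (card A - card B) * ((\<Prod>i\<in>B. \<delta> (x i)) *
          of_bool (\<exists>l<L. y + (\<Sum>l'\<le>l. \<delta> l') \<le> card {i \<in> B. x i \<le> l}))"
        unfolding 1 2 by simp
    qed
    also have "\<dots> \<le> (\<Sum>B\<in>Pow A. \<delta> L ^ (card A - card B) * (fact (card B) * crossing_poly (card B) b y))"
    proof (rule sum_mono)
      fix B assume "B \<in> Pow A"
      then have "finite B" using Suc.prems finite_subset by auto
      from Suc.IH[OF this]
      show "(\<Sum>x\<in>B \<rightarrow>\<^sub>E {..<L}. \<delta> L ^ (card A - card B) * ((\<Prod>i\<in>B. \<delta> (x i)) *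
          of_bool (\<exists>l<L. y + (\<Sum>l'\<le>l. \<delta> l') \<le> card {i \<in> B. x i \<le> l})))
        \<le> \<delta> L ^ (card A - card B) * (fact (card B) * crossing_poly (card B) b y)"
        unfolding sum_distrib_left[symmetric] b_def
        by (intro mult_left_mono) (auto simp: assms)
    qed
    also have "\<dots> = fact (card A) * crossing_poly (card A) (b + \<delta> L) y"
      unfolding crossing_poly_add_binomial
      using sum_Pow_card[OF Suc.prems, of "\<lambda>i. \<delta> L ^ (card A - i) * (fact i * crossing_poly i b y)"] by simp
    finally show ?thesis by (simp add: b_def)
  qed
qed

text \<open>Scaling the weights to \<open>n * q l\<close> turns the boundary into their cumulative
  sum, at the price of the factor \<open>n ^ n\<close>.\<close>

lemma iid_crossing_prob_le:
  fixes q :: "nat \<Rightarrow> real"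
  assumes "\<And>l. 0 \<le> q l" "(\<Sum>l<L. q l) = 1" "0 < y" "finite A" "card A = n" "0 < n"
  shows "(\<Sum>x\<in>A \<rightarrow>\<^sub>E {..<L}. (\<Prod>i\<in>A. q (x i)) *
      of_bool (\<exists>l<L. y + n * (\<Sum>l'\<le>l. q l') \<le> card {i \<in> A. x i \<le> l})) \<le> crossing_bound n n y"
proof -
  have "real n ^ n * (\<Sum>x\<in>A \<rightarrow>\<^sub>E {..<L}. (\<Prod>i\<in>A. q (x i)) *
      of_bool (\<exists>l<L. y + n * (\<Sum>l'\<le>l. q l') \<le> card {i \<in> A. x i \<le> l})) =
    (\<Sum>x\<in>A \<rightarrow>\<^sub>E {..<L}. (\<Prod>i\<in>A. n * q (x i)) *
      of_bool (\<exists>l<L. y + (\<Sum>l'\<le>l. n * q l') \<le> card {i \<in> A. x i \<le> l}))"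
    using assms by (simp add: prod.distrib sum_distrib_left mult_ac)
  also have "\<dots> \<le> fact n * crossing_poly n (\<Sum>l<L. n * q l) y"
    using iid_crossing_le[of "\<lambda>l. n * q l" y A L] assms by simp
  also have "(\<Sum>l<L. n * q l) = n" using assms by (simp flip: sum_distrib_left)
  finally show ?thesis using assms by (simp add: crossing_bound_def field_simps)
qed

section \<open>Mixing two distributions\<close>

text \<open>The length of
  \<open>{0..1} \<inter> {u + 1..u + 2} \<inter> {v + 1..v + 2}\<close>.\<close>

definition overlap :: "real \<Rightarrow> real \<Rightarrow> real" where
  "overlap u v = max 0 (min 1 (min (u + 2) (v + 2)) - max 0 (max (u + 1) (v + 1)))"

lemma overlap_has_integral:
  "((\<lambda>y. indicator {u + 1..u + 2} y * indicator {v + 1..v + 2} y) has_integral overlap u v) {0..1::real}"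
proof -
  define lo hi where "lo = max 0 (max (u + 1) (v + 1))" and "hi = min 1 (min (u + 2) (v + 2))"
  have int: "((\<lambda>y. if y \<in> {lo..hi} then 1 else 0) has_integral overlap u v) {0..1::real}"
  proof (subst has_integral_restrict)
    show "((\<lambda>_. 1) has_integral overlap u v) {lo..hi}"
    proof -
      have "overlap u v = max 0 (hi - lo)" by (simp add: overlap_def lo_def hi_def)
      then show ?thesis using has_integral_const_real[of "1::real" lo hi] by (simp add: max_def)
    qed
  qed (auto simp: lo_def hi_def)
  have J: "{lo..hi} = {0..1} \<inter> {u + 1..u + 2} \<inter> {v + 1..v + 2}"
    unfolding lo_def hi_def by (rule set_eqI) (simp only: atLeastAtMost_iff Int_iff max.bounded_iff min.bounded_iff conj_ac)
  from int show ?thesis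
    unfolding J by (elim has_integral_eq[rotated]) (auto simp: indicator_def)
qed

text \<open>\<open>overlap\<close> is the Gram kernel of indicator functions of unit intervals, cut off to \<open>[0, 1]\<close>.\<close>

lemma overlap_psd:
  assumes "finite S"
  shows "0 \<le> (\<Sum>s\<in>S. \<Sum>t\<in>S. d s * d t * overlap (u s) (u t))"
proof -
  have "((\<lambda>y. \<Sum>s\<in>S. \<Sum>t\<in>S. d s * d t * (indicator {u s + 1..u s + 2} y * indicator {u t + 1..u t + 2} y))
      has_integral (\<Sum>s\<in>S. \<Sum>t\<in>S. d s * d t * overlap (u s) (u t))) {0..1}"
    using assms by (intro has_integral_sum has_integral_mult_right overlap_has_integral)
  moreover have "(\<Sum>s\<in>S. \<Sum>t\<in>S. d s * d t * (indicator {u s + 1..u s + 2} y * indicator {u t + 1..u t + 2} y))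
     = (\<Sum>s\<in>S. d s * indicator {u s + 1..u s + 2} y)\<^sup>2" for y :: real
    unfolding power2_eq_square sum_product by (intro sum.cong refl) (simp only: mult_ac)
  ultimately show ?thesis
    by (elim has_integral_nonneg) (simp only: zero_le_power2)
qed

text \<open>Splits the kernel into terms in one variable, which vanish against weights of total mass
  zero, and the positive semidefinite \<open>overlap\<close>.\<close>

lemma hinge_kernel_eq_overlap:
  fixes u v :: real
  assumes "u \<le> 0" "v \<le> 0"
  shows "max 0 (max (max u v + 1) (min u v + 2)) = max 0 (u + 1) + max 0 (v + 1) + overlap u v"
proof -
  have "max 0 (max (v + 1) (u + 2)) = max 0 (u + 1) + max 0 (v + 1) + max 0 (min 1 (u + 2) - max 0 (v + 1))"
    if "u \<le> v" "v \<le> 0" for u v :: real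
    using that by (cases "- 1 \<le> u"; cases "- 1 \<le> v"; cases "- 2 \<le> u"; cases "v + 1 \<le> u + 2"; simp)
  from this[of u v] this[of v u] assms show ?thesis
    by (cases "u \<le> v") (simp_all add: overlap_def)
qed

lemma eq_if_same_upper_bounds:
  fixes x y :: real
  assumes "\<And>z. x \<le> z \<longleftrightarrow> y \<le> z"
  shows "x = y"
  using assms by (metis order_antisym order_refl)

text \<open>The positive part of \<open>D - a\<close> as a function of the cells \<open>s\<close>
  and \<open>t\<close> of two variables; \<open>r l\<close> is the count of all other variables
  minus the boundary at level \<open>l\<close>.\<close>

definition pair_excess :: "nat \<Rightarrow> (nat \<Rightarrow> real) \<Rightarrow> nat \<Rightarrow> nat \<Rightarrow> real" where
  "pair_excess L r s t = max 0 (Max ((\<lambda>l. r l + of_bool (s \<le> l) + of_bool (t \<le> l)) ` {..<L}))"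

lemma pair_excess_commute: "pair_excess L r s t = pair_excess L r t s"
  by (simp add: pair_excess_def add_ac)

text \<open>For \<open>s \<le> t\<close> the levels from \<open>s\<close> on are raised by 1 and
  those from \<open>t\<close> on by 2, so only the maxima of \<open>r\<close> over these two ranges
  and over all levels matter; \<open>u\<close> measures them relative to \<open>m\<close>.\<close>

lemma pair_excess_eq:
  fixes r :: "nat \<Rightarrow> real"
  assumes "s < L" "t < L"
  defines "m \<equiv> max 0 (Max (r ` {..<L}))"
  defines "u \<equiv> \<lambda>s. Max (r ` {s..<L}) - m"
  shows "pair_excess L r s t = m + (max 0 (u s + 1) + max 0 (u t + 1) + overlap (u s) (u t))"
proof -
  have le: "u s \<le> 0" if "s < L" for s
  proof -
    have "Max (r ` {s..<L}) \<le> Max (r ` {..<L})" using that by (intro Max_mono) auto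
    then show ?thesis by (simp add: u_def m_def)
  qed
  have anti: "Max (r ` {t..<L}) \<le> Max (r ` {s..<L})" if "s \<le> t" "t < L" for s t
    using that by (intro Max_mono) auto
  have *: "pair_excess L r s t = m + max 0 (max (max (u s) (u t) + 1) (min (u s) (u t) + 2))"
    if st: "s \<le> t" "t < L" for s t
  proof (rule eq_if_same_upper_bounds)
    fix z
    have a: "max (u s) (u t) = u s" "min (u s) (u t) = u t"
      using anti[OF st] by (auto simp: u_def)
    have "m + max 0 (max (u s + 1) (u t + 2)) \<le> z \<longleftrightarrow>
       m \<le> z \<and> Max (r ` {s..<L}) \<le> z - 1 \<and> Max (r ` {t..<L}) \<le> z - 2"
      by (auto simp: u_def)
    also have "\<dots> \<longleftrightarrow> 0 \<le> z \<and> (\<forall>l<L. r l \<le> z) \<and> (\<forall>l\<in>{s..<L}. r l \<le> z - 1) \<and> (\<forall>l\<in>{t..<L}. r l \<le> z - 2)"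
    proof -
      have "Max (r ` {..<L}) \<le> z \<longleftrightarrow> (\<forall>l<L. r l \<le> z)"
        using st by (subst Max_le_iff) auto
      then show ?thesis using st by (simp add: m_def)
    qed
    \<comment> \<open>The weaker bounds \<open>z\<close> and \<open>z - 1\<close> are implied at
      later levels by the stricter ones there, so each level need only satisfy its own.\<close>
    also have "\<dots> \<longleftrightarrow> 0 \<le> z \<and> (\<forall>l<L. r l + of_bool (s \<le> l) + of_bool (t \<le> l) \<le> z)" (is "?P \<longleftrightarrow> ?Q")
    proof
      assume P: ?P
      have "r l + of_bool (s \<le> l) + of_bool (t \<le> l) \<le> z" if "l < L" for l
      proof -
        have "r l \<le> z" "s \<le> l \<Longrightarrow> r l \<le> z - 1" "t \<le> l \<Longrightarrow> r l \<le> z - 2"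
          using P that by auto
        then show ?thesis using st by (auto simp: of_bool_def)
      qed
      then show ?Q using P by simp
    next
      assume Q: ?Q
      have "r l \<le> z" "s \<le> l \<Longrightarrow> r l \<le> z - 1" "t \<le> l \<Longrightarrow> r l \<le> z - 2" if "l < L" for l
      proof -
        have "r l + of_bool (s \<le> l) + of_bool (t \<le> l) \<le> z" using Q that by simp
        then show "r l \<le> z" "s \<le> l \<Longrightarrow> r l \<le> z - 1" "t \<le> l \<Longrightarrow> r l \<le> z - 2"
          using st by (auto simp: of_bool_def split: if_splits)
      qed
      then show ?P using Q by auto
    qed
    also have "\<dots> \<longleftrightarrow> pair_excess L r s t \<le> z"
      using st unfolding pair_excess_def by (subst max.bounded_iff, subst Max_le_iff) auto
    finally show "pair_excess L r s t \<le> z \<longleftrightarrow> m + max 0 (max (max (u s) (u t) + 1) (min (u s) (u t) + 2)) \<le> z"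
      by (simp add: a)
  qed
  have "pair_excess L r s t = m + max 0 (max (max (u s) (u t) + 1) (min (u s) (u t) + 2))"
  proof (cases "s \<le> t")
    case False
    have "pair_excess L r s t = pair_excess L r t s" by (rule pair_excess_commute)
    also have "\<dots> = m + max 0 (max (max (u t) (u s) + 1) (min (u t) (u s) + 2))"
      using False assms(1) by (intro *) auto
    finally show ?thesis by (simp only: max.commute[of "u t"] min.commute[of "u t"])
  qed (intro *, use assms(2) in auto)
  then show ?thesis
    unfolding hinge_kernel_eq_overlap[OF le[OF assms(1)] le[OF assms(2)]] .
qed

lemma pair_excess_conditionally_psd:
  assumes "(\<Sum>s<L. d s) = 0"
  shows "0 \<le> (\<Sum>s<L. \<Sum>t<L. d s * d t * pair_excess L r s t)"
proof -
  define m where "m = max 0 (Max (r ` {..<L}))"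
  define u where "u s = Max (r ` {s..<L}) - m" for s
  define f where "f s = max 0 (u s + 1)" for s
  have eq: "pair_excess L r s t = m + (f s + f t + overlap (u s) (u t))" if "s < L" "t < L" for s t
    using pair_excess_eq[OF that, of r] unfolding f_def u_def m_def .
  have "(\<Sum>s<L. \<Sum>t<L. d s * d t * pair_excess L r s t) =
     (\<Sum>s<L. \<Sum>t<L. (d s * (m + f s)) * d t + d s * (d t * f t) + d s * d t * overlap (u s) (u t))"
    by (intro sum.cong refl) (simp add: eq algebra_simps)
  also have "\<dots> = (\<Sum>s<L. d s * (m + f s)) * (\<Sum>t<L. d t) + (\<Sum>s<L. d s) * (\<Sum>t<L. d t * f t)
      + (\<Sum>s<L. \<Sum>t<L. d s * d t * overlap (u s) (u t))"
    by (simp only: sum.distrib sum_product)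
  also have "\<dots> = (\<Sum>s<L. \<Sum>t<L. d s * d t * overlap (u s) (u t))"
    using assms by simp
  finally show ?thesis using overlap_psd[of "{..<L}" d u] by simp
qed

text \<open>By bilinearity and symmetry the gain is \<open>w * (1 - w)\<close> times the quadratic
  form at \<open>p - q\<close>, which has total mass zero.\<close>

lemma pair_excess_mix_le:
  fixes p q :: "nat \<Rightarrow> real" and w :: real
  assumes "(\<Sum>s<L. p s) = (\<Sum>s<L. q s)" "0 \<le> w" "w \<le> 1"
  shows "(\<Sum>s<L. \<Sum>t<L. p s * q t * pair_excess L r s t) \<le>
    (\<Sum>s<L. \<Sum>t<L. ((1 - w) * p s + w * q s) * (w * p t + (1 - w) * q t) * pair_excess L r s t)"
proof -
  define B where "B p q = (\<Sum>s<L. \<Sum>t<L. p s * q t * pair_excess L r s t)" for p q :: "nat \<Rightarrow> real"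
  have sym: "B q p = B p q"
  proof -
    have "B q p = (\<Sum>t<L. \<Sum>s<L. q s * p t * pair_excess L r s t)"
      unfolding B_def by (rule sum.swap)
    also have "\<dots> = B p q"
      unfolding B_def by (intro sum.cong refl) (simp add: pair_excess_commute[of L r] mult.commute)
    finally show ?thesis .
  qed
  have 1: "B (\<lambda>s. (1 - w) * p s + w * q s) (\<lambda>t. w * p t + (1 - w) * q t) =
     (1 - w) * w * B p p + w * (1 - w) * B q q + (1 - w)\<^sup>2 * B p q + w\<^sup>2 * B q p"
    unfolding B_def sum_distrib_left sum.distrib[symmetric]
    by (intro sum.cong refl) (simp add: algebra_simps power2_eq_square)
  have 2: "B (\<lambda>s. p s - q s) (\<lambda>s. p s - q s) = B p p + B q q - B p q - B q p"
    unfolding B_def sum_subtractf[symmetric] sum.distrib[symmetric]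
    by (intro sum.cong refl) (simp add: algebra_simps)
  have "0 \<le> B (\<lambda>s. p s - q s) (\<lambda>s. p s - q s)"
    unfolding B_def using assms by (intro pair_excess_conditionally_psd) (simp add: sum_subtractf)
  have "B (\<lambda>s. (1 - w) * p s + w * q s) (\<lambda>t. w * p t + (1 - w) * q t) - B p q
     = w * (1 - w) * B (\<lambda>s. p s - q s) (\<lambda>s. p s - q s)"
    unfolding 1 2 sym by (simp add: algebra_simps power2_eq_square)
  moreover have "0 \<le> w * (1 - w) * B (\<lambda>s. p s - q s) (\<lambda>s. p s - q s)"
    using assms \<open>0 \<le> B (\<lambda>s. p s - q s) (\<lambda>s. p s - q s)\<close> by simp
  ultimately show ?thesis by (simp add: B_def)
qed

section \<open>Expectations under products of distributions on finitely many cells\<close>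

definition product_sum :: "'i set \<Rightarrow> nat \<Rightarrow> ('i \<Rightarrow> nat \<Rightarrow> real) \<Rightarrow> (('i \<Rightarrow> nat) \<Rightarrow> real) \<Rightarrow> real" where
  "product_sum I L q f = (\<Sum>x\<in>I \<rightarrow>\<^sub>E {..<L}. (\<Prod>i\<in>I. q i (x i)) * f x)"

lemma sum_PiE_insert:
  fixes g :: "('i \<Rightarrow> nat) \<Rightarrow> real"
  assumes "i \<notin> I"
  shows "(\<Sum>x\<in>insert i I \<rightarrow>\<^sub>E S. g x) = (\<Sum>s\<in>S. \<Sum>x\<in>I \<rightarrow>\<^sub>E S. g (x(i := s)))"
proof -
  have "(\<Sum>x\<in>insert i I \<rightarrow>\<^sub>E S. g x) = (\<Sum>(s, x)\<in>S \<times> (I \<rightarrow>\<^sub>E S). g (x(i := s)))"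
    unfolding PiE_insert_eq
    by (subst sum.reindex) (use assms inj_combinator in \<open>auto simp: case_prod_unfold\<close>)
  then show ?thesis by (simp add: sum.cartesian_product)
qed

lemma product_sum_insert2:
  fixes I :: "'i set"
  assumes "finite I" "i \<notin> I" "j \<notin> I" "i \<noteq> j"
  shows "product_sum (insert i (insert j I)) L q f =
    (\<Sum>x\<in>I \<rightarrow>\<^sub>E {..<L}. (\<Prod>k\<in>I. q k (x k)) * (\<Sum>s<L. \<Sum>t<L. q i s * q j t * f (x(j := t, i := s))))"
proof -
  have "product_sum (insert i (insert j I)) L q f =
    (\<Sum>s<L. \<Sum>t<L. \<Sum>x\<in>I \<rightarrow>\<^sub>E {..<L}. (\<Prod>k\<in>I. q k (x k)) * (q i s * q j t * f (x(j := t, i := s))))"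
  proof -
    have "(\<Prod>k\<in>insert i (insert j I). q k ((x(j := t, i := s)) k)) = q i s * q j t * (\<Prod>k\<in>I. q k (x k))"
      for s t x
    proof -
      have "(\<Prod>k\<in>I. q k ((x(j := t, i := s)) k)) = (\<Prod>k\<in>I. q k (x k))"
        using assms by (intro prod.cong) auto
      then show ?thesis using assms by simp
    qed
    moreover have "i \<notin> insert j I" using assms by simp
    ultimately show ?thesis
      unfolding product_sum_def sum_PiE_insert[OF \<open>i \<notin> insert j I\<close>] sum_PiE_insert[OF assms(3)]
      by (intro sum.cong refl) (simp only: mult_ac)
  qed
  also have "\<dots> = (\<Sum>x\<in>I \<rightarrow>\<^sub>E {..<L}. \<Sum>s<L. \<Sum>t<L. (\<Prod>k\<in>I. q k (x k)) * (q i s * q j t * f (x(j := t, i := s))))"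
  proof -
    have "(\<Sum>s<L. \<Sum>t<L. \<Sum>x\<in>X. h s t x) = (\<Sum>x\<in>X. \<Sum>s<L. \<Sum>t<L. h s t x)"
      for X :: "('i \<Rightarrow> nat) set" and h :: "nat \<Rightarrow> nat \<Rightarrow> _ \<Rightarrow> real"
    proof -
      have "(\<Sum>s<L. \<Sum>t<L. \<Sum>x\<in>X. h s t x) = (\<Sum>s<L. \<Sum>x\<in>X. \<Sum>t<L. h s t x)"
        by (intro sum.cong refl sum.swap)
      also have "\<dots> = (\<Sum>x\<in>X. \<Sum>s<L. \<Sum>t<L. h s t x)" by (rule sum.swap)
      finally show ?thesis .
    qed
    then show ?thesis .
  qed
  finally show ?thesis by (simp add: sum_distrib_left)
qed

text \<open>The positive part of \<open>D - a\<close>: in the application \<open>g\<close> is the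
  mean of the counting process plus the shift \<open>a\<close>.\<close>

definition excess :: "'i set \<Rightarrow> nat \<Rightarrow> (nat \<Rightarrow> real) \<Rightarrow> ('i \<Rightarrow> nat) \<Rightarrow> real" where
  "excess I L g x = max 0 (Max ((\<lambda>l. real (card {i \<in> I. x i \<le> l}) - g l) ` {..<L}))"

lemma excess_insert2:
  assumes "finite I" "i \<notin> I" "j \<notin> I" "i \<noteq> j"
  shows "excess (insert i (insert j I)) L g (x(j := t, i := s)) = pair_excess L (\<lambda>l. real (card {k \<in> I. x k \<le> l}) - g l) s t"
proof -
  have "card {k \<in> insert i (insert j I). (x(j := t, i := s)) k \<le> l} = card {k \<in> I. x k \<le> l} + of_bool (s \<le> l) + of_bool (t \<le> l)" for l
  proof -
    have "{k \<in> insert i (insert j I). (x(j := t, i := s)) k \<le> l} =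
      (if s \<le> l then {i} else {}) \<union> ((if t \<le> l then {j} else {}) \<union> {k \<in> I. x k \<le> l})"
      using assms by auto
    then show ?thesis using assms by simp
  qed
  then show ?thesis by (simp add: excess_def pair_excess_def algebra_simps)
qed

text \<open>\<open>pair_excess_mix_le\<close> applies with the cells of all other variables fixed.
  The sum \<open>q i + q j\<close> is preserved, so \<open>g\<close> remains the right boundary
  during the mixing.\<close>

lemma product_sum_mix_le:
  fixes w :: real
  assumes "finite I" "i \<in> I" "j \<in> I" "i \<noteq> j" "0 \<le> w" "w \<le> 1"
    and "\<And>k l. k \<in> I \<Longrightarrow> 0 \<le> q k l" "(\<Sum>l<L. q i l) = (\<Sum>l<L. q j l)"
  shows "product_sum I L q (excess I L g) \<le>
    product_sum I L (q(i := (\<lambda>l. (1 - w) * q i l + w * q j l), j := (\<lambda>l. w * q i l + (1 - w) * q j l))) (excess I L g)"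
proof -
  define K where "K = I - {i, j}"
  have K: "finite K" "i \<notin> K" "j \<notin> K" "I = insert i (insert j K)"
    using assms by (auto simp: K_def)
  define q' where "q' = q(i := (\<lambda>l. (1 - w) * q i l + w * q j l), j := (\<lambda>l. w * q i l + (1 - w) * q j l))"
  have eq: "(\<Prod>k\<in>K. q' k (x k)) = (\<Prod>k\<in>K. q k (x k))" for x
    using K by (intro prod.cong) (auto simp: q'_def)
  show ?thesis
    unfolding q'_def[symmetric] K(4) product_sum_insert2[OF K(1-3) assms(4)] excess_insert2[OF K(1-3) assms(4)] eq
  proof (rule sum_mono, rule mult_left_mono)
    fix x
    show "(\<Sum>s<L. \<Sum>t<L. q i s * q j t * pair_excess L (\<lambda>l. real (card {k \<in> K. x k \<le> l}) - g l) s t)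
       \<le> (\<Sum>s<L. \<Sum>t<L. q' i s * q' j t * pair_excess L (\<lambda>l. real (card {k \<in> K. x k \<le> l}) - g l) s t)"
      using pair_excess_mix_le[OF assms(8,5,6)] assms(4) by (simp add: q'_def)
    show "0 \<le> (\<Prod>k\<in>K. q k (x k))"
      using assms(7) K(4) by (intro prod_nonneg) auto
  qed
qed

section \<open>Averaging all distributions\<close>

text \<open>Mixing \<open>q k\<close> with weight \<open>1 / (card J + 1)\<close> into one of the equal distributions makes the latter final; the mean of
  the remaining ones is unchanged.\<close>

lemma product_sum_spread_le:
  fixes A R :: "nat \<Rightarrow> real"
  assumes "finite J" "finite I" "J \<subseteq> I" "k \<in> I" "k \<notin> J"
    and "\<And>i. i \<in> J \<Longrightarrow> q i = A" "q k = R"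
    and "\<And>i l. i \<in> I \<Longrightarrow> 0 \<le> q i l" "\<And>i. i \<in> I \<Longrightarrow> (\<Sum>l<L. q i l) = 1"
  shows "product_sum I L q (excess I L g) \<le>
    product_sum I L (\<lambda>i. if i \<in> insert k J then \<lambda>l. (real (card J) * A l + R l) / (real (card J) + 1) else q i) (excess I L g)"
  using assms
proof (induction J arbitrary: q R)
  case empty
  then have "(\<lambda>i. if i = k then R else q i) = q" by auto
  then show ?case by (simp cong: if_cong)
next
  case (insert i J)
  \<comment> \<open>Here \<open>J\<close> lacks \<open>i\<close>; together with \<open>i\<close> and
    \<open>k\<close> there are \<open>card J + 2\<close> distributions, and the mixed
    \<open>q i\<close> is their mean.\<close>
  define w where "w = 1 / (real (card J) + 2)"
  have w: "0 \<le> w" "w \<le> 1" by (auto simp: w_def)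
  define R' where "R' = (\<lambda>l. w * A l + (1 - w) * R l)"
  define q' where "q' = q(i := (\<lambda>l. (1 - w) * q i l + w * q k l), k := (\<lambda>l. w * q i l + (1 - w) * q k l))"
  have ik: "i \<in> I" "k \<in> I" "i \<noteq> k" "q i = A" "q k = R" using insert.prems by auto
  have "product_sum I L q (excess I L g) \<le> product_sum I L q' (excess I L g)"
    unfolding q'_def using insert.prems(1,7) ik(1-3) w insert.prems(8)[OF ik(1)] insert.prems(8)[OF ik(2)] by (intro product_sum_mix_le) auto
  also have "\<dots> \<le> product_sum I L (\<lambda>j. if j \<in> insert k J then \<lambda>l. (real (card J) * A l + R' l) / (real (card J) + 1) else q' j) (excess I L g)"
  proof (rule insert.IH)
    show "0 \<le> q' j l" if "j \<in> I" for j l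
      using insert.prems(7) that ik w by (auto simp: q'_def)
    show "(\<Sum>l<L. q' j l) = 1" if "j \<in> I" for j
    proof -
      have "(\<Sum>l<L. u * q i l + v * q k l) = u + v" for u v
        using insert.prems(8) ik(1,2) by (simp add: sum.distrib flip: sum_distrib_left)
      then show ?thesis using insert.prems(8) that by (simp add: q'_def)
    qed
  qed (use insert ik in \<open>auto simp: q'_def R'_def\<close>)
  also have "(\<lambda>j. if j \<in> insert k J then \<lambda>l. (real (card J) * A l + R' l) / (real (card J) + 1) else q' j) =
     (\<lambda>j. if j \<in> insert k (insert i J) then \<lambda>l. (real (card (insert i J)) * A l + R l) / (real (card (insert i J)) + 1) else q j)"
  proof -
    have c: "real (card (insert i J)) = real (card J) + 1" using insert.hyps by simp
    have 1: "(real (card J) * A l + R' l) / (real (card J) + 1) = ((real (card J) + 1) * A l + R l) / (real (card J) + 1 + 1)" for l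
      by (simp add: R'_def w_def divide_simps) (simp add: algebra_simps)
    have 2: "(1 - w) * A l + w * R l = ((real (card J) + 1) * A l + R l) / (real (card J) + 1 + 1)" for l
      by (simp add: w_def divide_simps) (simp add: algebra_simps)
    show ?thesis
      unfolding c 1 using insert.hyps insert.prems ik by (auto simp: fun_eq_iff q'_def 2)
  qed
  finally show ?case .
qed

text \<open>Once the distributions over \<open>J\<close> agree, \<open>product_sum_spread_le\<close>
  averages the next one with them.\<close>

lemma product_sum_average_le:
  assumes "finite J" "J \<noteq> {}" "finite I" "J \<subseteq> I"
    and "\<And>i l. i \<in> I \<Longrightarrow> 0 \<le> q i l" "\<And>i. i \<in> I \<Longrightarrow> (\<Sum>l<L. q i l) = 1"
  shows "product_sum I L q (excess I L g) \<le>
    product_sum I L (\<lambda>i. if i \<in> J then \<lambda>l. (\<Sum>i\<in>J. q i l) / card J else q i) (excess I L g)"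
  using assms
proof (induction J rule: finite_ne_induct)
  case (singleton k)
  have "(\<lambda>i. if i \<in> {k} then \<lambda>l. (\<Sum>i\<in>{k}. q i l) / card {k} else q i) = q"
    by (auto simp: fun_eq_iff)
  then show ?case by simp
next
  case (insert k J)
  define A where "A l = (\<Sum>i\<in>J. q i l) / card J" for l
  define q' where "q' i = (if i \<in> J then A else q i)" for i
  have J: "real (card J) > 0" using insert.hyps by (simp add: card_gt_0_iff)
  have "product_sum I L q (excess I L g) \<le> product_sum I L q' (excess I L g)"
    unfolding q'_def[abs_def] A_def[abs_def] using insert by auto
  also have "\<dots> \<le> product_sum I L (\<lambda>i. if i \<in> insert k J then \<lambda>l. (real (card J) * A l + q k l) / (real (card J) + 1) else q' i) (excess I L g)"
  proof (rule product_sum_spread_le)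
    show "0 \<le> q' i l" if "i \<in> I" for i l
      using insert.prems that by (auto simp: q'_def A_def intro!: sum_nonneg divide_nonneg_nonneg)
    show "(\<Sum>l<L. q' i l) = 1" if "i \<in> I" for i
    proof -
      have "(\<Sum>l<L. A l) = (\<Sum>i\<in>J. \<Sum>l<L. q i l) / card J"
        unfolding A_def sum_divide_distrib[symmetric] by (subst sum.swap) simp
      also have "(\<Sum>i\<in>J. \<Sum>l<L. q i l) = (\<Sum>i\<in>J. 1)"
        using insert.prems by (intro sum.cong) auto
      finally have "(\<Sum>l<L. A l) = 1" using J by simp
      then show ?thesis using insert.prems that by (simp add: q'_def)
    qed
  qed (use insert in \<open>auto simp: q'_def\<close>)
  also have "(\<lambda>i. if i \<in> insert k J then \<lambda>l. (real (card J) * A l + q k l) / (real (card J) + 1) else q' i) =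
     (\<lambda>i. if i \<in> insert k J then \<lambda>l. (\<Sum>i\<in>insert k J. q i l) / card (insert k J) else q i)"
    using insert.hyps J by (auto simp: fun_eq_iff q'_def A_def add_ac)
  finally show ?case .
qed

text \<open>The positive part of \<open>D - a\<close> is the integral over \<open>y \<ge> a\<close>
  of the indicator of \<open>y \<le> D\<close>, and \<open>iid_crossing_prob_le\<close> bounds the
  expected integrand.\<close>

lemma iid_excess_le:
  fixes q :: "nat \<Rightarrow> real"
  assumes q: "\<And>l. 0 \<le> q l" "(\<Sum>l<L. q l) = 1" and I: "finite I" "card I = n" "0 < n" and a: "0 < a"
  shows "product_sum I L (\<lambda>_. q) (excess I L (\<lambda>l. n * (\<Sum>l'\<le>l. q l') + a)) \<le> crossing_tail n n a"
proof -
  have L: "0 < L" using q by (cases L) auto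
  define D where "D x = Max ((\<lambda>l. real (card {i \<in> I. x i \<le> l}) - n * (\<Sum>l'\<le>l. q l')) ` {..<L})" for x
  have Dn: "D x \<le> n" for x
  proof -
    have "real (card {i \<in> I. x i \<le> l}) - n * (\<Sum>l'\<le>l. q l') \<le> n" for l
    proof -
      have "card {i \<in> I. x i \<le> l} \<le> n" using I by (auto intro!: card_mono)
      moreover have "0 \<le> n * (\<Sum>l'\<le>l. q l')" using q by (simp add: sum_nonneg)
      ultimately show ?thesis by linarith
    qed
    then show ?thesis unfolding D_def using L by (subst Max_le_iff) auto
  qed
  have Dge: "y \<le> D x \<longleftrightarrow> (\<exists>l<L. y + n * (\<Sum>l'\<le>l. q l') \<le> card {i \<in> I. x i \<le> l})" for x y
    unfolding D_def using L by (subst Max_ge_iff) (auto simp: le_diff_eq)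
  have ex: "excess I L (\<lambda>l. n * (\<Sum>l'\<le>l. q l') + a) x = max 0 (D x - a)" for x
  proof -
    have "D x - a = Max ((\<lambda>l. real (card {i \<in> I. x i \<le> l}) - (n * (\<Sum>l'\<le>l. q l') + a)) ` {..<L})"
    proof -
      have "(\<lambda>y. y - a) (D x) = Max ((\<lambda>y. y - a) ` ((\<lambda>l. real (card {i \<in> I. x i \<le> l}) - n * (\<Sum>l'\<le>l. q l')) ` {..<L}))"
        unfolding D_def using L by (intro mono_Max_commute) (auto intro: monoI)
      then show ?thesis by (simp add: image_image algebra_simps)
    qed
    then show ?thesis by (simp add: excess_def)
  qed
  show ?thesis
  proof (cases "a \<le> n + 2")
    case True
    have int: "((\<lambda>y. of_bool (y \<le> D x)) has_integral max 0 (D x - a)) {a..real n + 2}" for x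
    proof -
      have "((\<lambda>y. if y \<in> {a..D x} then 1 else 0) has_integral max 0 (D x - a)) {a..real n + 2}"
      proof (subst has_integral_restrict)
        show "((\<lambda>_. 1) has_integral max 0 (D x - a)) {a..D x}"
          using has_integral_const_real[of "1::real" a "D x"] by (simp add: max_def)
      qed (use Dn[of x] in auto)
      then show ?thesis by (elim has_integral_eq[rotated]) auto
    qed
    have "((\<lambda>y. product_sum I L (\<lambda>_. q) (\<lambda>x. of_bool (y \<le> D x))) has_integral
       product_sum I L (\<lambda>_. q) (\<lambda>x. max 0 (D x - a))) {a..real n + 2}"
      unfolding product_sum_def using I by (intro has_integral_sum has_integral_mult_right int finite_PiE) auto
    moreover have "(crossing_bound n n has_integral crossing_tail n n a) {a..real n + 2}"
      unfolding crossing_tail_def by (intro integrable_integral crossing_bound_integrable)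
    moreover have "product_sum I L (\<lambda>_. q) (\<lambda>x. of_bool (y \<le> D x)) \<le> crossing_bound n n y" if "y \<in> {a..real n + 2}" for y
      unfolding product_sum_def Dge using iid_crossing_prob_le[OF q, of y I n] I a that by simp
    ultimately show ?thesis
      unfolding ex by (rule has_integral_le)
  next
    case False
    then have "max 0 (D x - a) = 0" for x using Dn[of x] by simp
    then show ?thesis unfolding ex using False by (simp add: product_sum_def crossing_tail_eq_0[OF I(3)])
  qed
qed

lemma discrete_crossing_le:
  fixes q :: "'i \<Rightarrow> nat \<Rightarrow> real"
  assumes I: "finite I" "card I = n" "0 < n"
    and q: "\<And>i l. i \<in> I \<Longrightarrow> 0 \<le> q i l" "\<And>i. i \<in> I \<Longrightarrow> (\<Sum>l<L. q i l) = 1"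
    and c: "0 \<le> c"
  shows "product_sum I L q (\<lambda>x. of_bool (\<exists>l<L. c + (\<Sum>i\<in>I. \<Sum>l'\<le>l. q i l') \<le> card {i \<in> I. x i \<le> l}))
     \<le> exp (1 - 2 * c\<^sup>2 / n)"
\<comment> \<open>In this range the right side is at least 1. It is also where the \<open>a\<close>
  chosen below would not be positive, as \<open>iid_excess_le\<close> demands.\<close>
proof (cases "c\<^sup>2 \<le> n / 4")
  case True
  have "product_sum I L q (\<lambda>x. of_bool (\<exists>l<L. c + (\<Sum>i\<in>I. \<Sum>l'\<le>l. q i l') \<le> card {i \<in> I. x i \<le> l}))
      \<le> (\<Sum>x\<in>I \<rightarrow>\<^sub>E {..<L}. \<Prod>i\<in>I. q i (x i))"
    unfolding product_sum_def using q by (intro sum_mono) (auto simp: prod_nonneg)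
  also have "\<dots> = (\<Prod>i\<in>I. \<Sum>l<L. q i l)"
    using I by (subst prod_sum_PiE) auto
  also have "\<dots> = 1" using q by simp
  also have "1 \<le> exp (1 - 2 * c\<^sup>2 / n)"
    using True I by (simp add: field_simps)
  finally show ?thesis .
next
  case False
  have c0: "0 < c" using False c I by (cases "c = 0") auto
  \<comment> \<open>With \<open>a = c - 1 / b\<close> the final exponent is
    \<open>n * b\<^sup>2 / 8 - b * c + 1\<close>, which this \<open>b\<close> minimises.\<close>
  define b where "b = 4 * c / n"
  define a where "a = c - 1 / b"
  have b: "0 < b" using c0 I by (simp add: b_def)
  have a: "0 < a" using False c0 I by (simp add: a_def b_def field_simps power2_eq_square)
  have L: "0 < L"
  proof -
    obtain i where "i \<in> I" using I by fastforce
    then show ?thesis using q(2)[of i] by (cases L) auto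
  qed
  define Q where "Q l = (\<Sum>i\<in>I. q i l) / n" for l
  define g where "g l = n * (\<Sum>l'\<le>l. Q l') + a" for l
  have g: "g l = (\<Sum>i\<in>I. \<Sum>l'\<le>l. q i l') + a" for l
  proof -
    have "n * Q l' = (\<Sum>i\<in>I. q i l')" for l' using I by (simp add: Q_def)
    then have "n * (\<Sum>l'\<le>l. Q l') = (\<Sum>l'\<le>l. \<Sum>i\<in>I. q i l')"
      by (simp add: sum_distrib_left)
    then show ?thesis by (simp add: g_def sum.swap[of _ I])
  qed
  have "product_sum I L q (\<lambda>x. of_bool (\<exists>l<L. c + (\<Sum>i\<in>I. \<Sum>l'\<le>l. q i l') \<le> card {i \<in> I. x i \<le> l}))
      \<le> product_sum I L q (\<lambda>x. b * excess I L g x)"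
    unfolding product_sum_def
  proof (intro sum_mono mult_left_mono)
    fix x
    show "of_bool (\<exists>l<L. c + (\<Sum>i\<in>I. \<Sum>l'\<le>l. q i l') \<le> card {i \<in> I. x i \<le> l}) \<le> b * excess I L g x"
    proof (cases "\<exists>l<L. c + (\<Sum>i\<in>I. \<Sum>l'\<le>l. q i l') \<le> card {i \<in> I. x i \<le> l}")
      case True
      then obtain l where l: "l < L" "c + (\<Sum>i\<in>I. \<Sum>l'\<le>l. q i l') \<le> card {i \<in> I. x i \<le> l}" by blast
      then have "1 / b \<le> real (card {i \<in> I. x i \<le> l}) - g l"
        unfolding g a_def by simp
      also have "\<dots> \<le> excess I L g x"
        unfolding excess_def using l by (intro max.coboundedI2 Max_ge) auto
      finally show ?thesis using b True by (simp add: field_simps)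
    next
      case False
      then show ?thesis using b by (auto simp: excess_def)
    qed
    show "0 \<le> (\<Prod>i\<in>I. q i (x i))" using q by (intro prod_nonneg) auto
  qed
  also have "\<dots> = b * product_sum I L q (excess I L g)"
    unfolding product_sum_def by (simp add: sum_distrib_left mult_ac)
  also have "\<dots> \<le> b * crossing_tail n n a"
  proof (rule mult_left_mono)
    have "product_sum I L q (excess I L g) \<le> product_sum I L (\<lambda>i. if i \<in> I then \<lambda>l. (\<Sum>i\<in>I. q i l) / card I else q i) (excess I L g)"
      using I q by (intro product_sum_average_le) auto
    also have "\<dots> = product_sum I L (\<lambda>_. Q) (excess I L g)"
      unfolding product_sum_def using I by (auto simp: Q_def intro!: sum.cong)
    also have "\<dots> \<le> crossing_tail n n a"
      unfolding g_def[abs_def]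
    proof (rule iid_excess_le[OF _ _ I a])
      show "0 \<le> Q l" for l using q by (auto simp: Q_def intro!: sum_nonneg divide_nonneg_nonneg)
      have "(\<Sum>l<L. Q l) = (\<Sum>i\<in>I. \<Sum>l<L. q i l) / n"
        unfolding Q_def sum_divide_distrib[symmetric] by (subst sum.swap) simp
      also have "(\<Sum>i\<in>I. \<Sum>l<L. q i l) = (\<Sum>i\<in>I. 1)" by (intro sum.cong q(2) refl)
      finally show "(\<Sum>l<L. Q l) = 1" using I by simp
    qed
    finally show "product_sum I L q (excess I L g) \<le> crossing_tail n n a" .
  qed (use b in simp)
  also have "\<dots> \<le> b * (exp (n * b\<^sup>2 / 8 - b * a) / b)"
  proof (cases "a \<le> n + 2")
    case True
    then show ?thesis using crossing_tail_le_exp[OF I(3) b, of a] b by (intro mult_left_mono) auto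
  next
    case False
    then show ?thesis using b by (simp add: crossing_tail_eq_0[OF I(3)])
  qed
  also have "\<dots> = exp (n * b\<^sup>2 / 8 - b * a)" using b by simp
  also have "n * b\<^sup>2 / 8 - b * a = 1 - 2 * c\<^sup>2 / n"
    using I c0 by (simp add: a_def b_def field_simps power2_eq_square)
  finally show ?thesis .
qed

section \<open>From the crossing event to the confidence bound\<close>

text \<open>Remove from \<open>A\<close> the head of the list if it occurs there and an arbitrary
  element otherwise; the rest is contained in the tail.\<close>

lemma sum_take_sorted_le:
  fixes ys :: "real list"
  assumes "sorted ys" "A \<subseteq># mset ys"
  shows "sum_list (take (size A) ys) \<le> sum_mset A"
  using assms
proof (induction ys arbitrary: A)
  case (Cons y ys)
  show ?case
  proof (cases "A = {#}")
    case False
    obtain a where a: "a \<in># A" "y \<le> a" "A - {#a#} \<subseteq># mset ys"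
    proof (cases "y \<in># A")
      case True
      then show ?thesis
        using Cons.prems that[of y] subset_eq_diff_conv[of A "{#y#}" "mset ys"] by simp
    next
      case F: False
      obtain a where "a \<in># A" using False by blast
      moreover have sub: "A \<subseteq># mset ys"
        using Cons.prems F subset_eq_diff_conv[of A "{#y#}" "mset ys"] by simp
      moreover have "y \<le> a"
        using mset_subset_eqD[OF sub \<open>a \<in># A\<close>] Cons.prems by simp
      moreover have "A - {#a#} \<subseteq># mset ys"
        by (rule subset_mset.order_trans[OF diff_subset_eq_self sub])
      ultimately show ?thesis using that by blast
    qed
    have "size A = Suc (size (A - {#a#}))"
      using size_Suc_Diff1[OF a(1)] by simp
    then have "sum_list (take (size A) (y # ys)) = y + sum_list (take (size (A - {#a#})) ys)" by simp
    also have "\<dots> \<le> a + sum_mset (A - {#a#})"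
      using Cons.IH[OF _ a(3)] Cons.prems a by (intro add_mono) auto
    also have "\<dots> = sum_mset A" by (rule sum_mset.remove[OF a(1), symmetric])
    finally show ?thesis .
  qed simp
qed simp

lemma sum_smallest_le:
  assumes "H \<subseteq> {1..m}"
  shows "sum_smallest (card H) (map f [1..<m + 1]) \<le> (\<Sum>i\<in>H. f i)"
proof -
  have "mset_set H \<subseteq># mset_set {1..m}" using assms by (intro subset_imp_msubset_mset_set) auto
  then have "image_mset f (mset_set H) \<subseteq># image_mset f (mset_set {1..m})" by (rule image_mset_subseteq_mono)
  moreover have "mset [1..<m + 1] = mset_set {1..m}"
    by (metis Suc_eq_plus1 atLeastLessThanSuc_atLeastAtMost mset_upt)
  ultimately have "image_mset f (mset_set H) \<subseteq># mset (sort (map f [1..<m + 1]))" by simp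
  from sum_take_sorted_le[OF _ this] show ?thesis
    by (simp add: sum_smallest_def sum_unfold_sum_mset)
qed

lemma sum_largest_ge:
  assumes "H \<subseteq> {1..m}"
  shows "(\<Sum>i\<in>H. f i) \<le> sum_largest (card H) (map f [1..<m + 1])"
proof -
  let ?xs = "map f [1..<m + 1]"
  have "sort (map uminus xs) = map uminus (rev (sort xs))" for xs :: "real list"
  proof (rule properties_for_sort)
    have "sorted_wrt (\<ge>) (rev (sort xs))" by (simp add: sorted_wrt_rev)
    then show "sorted (map uminus (rev (sort xs)))" by (simp add: sorted_map)
  qed simp
  from this[of ?xs] have "sum_smallest (card H) (map uminus ?xs) = - sum_largest (card H) ?xs"
    using uminus_sum_list_map[of "\<lambda>x. x" "take (card H) (rev (sort ?xs))"]
    by (simp add: sum_smallest_def sum_largest_def take_map o_def del: upt_Suc)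
  then show ?thesis
    using sum_smallest_le[OF assms, of "\<lambda>i. - f i"] by (simp add: o_def sum_negf del: upt_Suc)
qed

lemma sum_largest_mono:
  assumes "n \<le> n'" "\<And>x. x \<in> set xs \<Longrightarrow> 0 \<le> x"
  shows "sum_largest n xs \<le> sum_largest n' xs"
proof -
  let ?ys = "rev (sort xs)"
  have "take n' ?ys = take n ?ys @ take (n' - n) (drop n ?ys)"
    using assms(1) by (metis le_add_diff_inverse take_add)
  moreover have "0 \<le> sum_list (take (n' - n) (drop n ?ys))"
    using assms(2) by (intro sum_list_nonneg) (auto dest!: in_set_takeD in_set_dropD)
  ultimately show ?thesis by (simp add: sum_largest_def)
qed

text \<open>The count jumps only at the values \<open>pv j\<close> and each \<open>F j\<close> is
  nondecreasing, so the worst threshold below \<open>t\<close> is the largest such value. This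
  reduces all \<open>t\<close> to finitely many.\<close>

lemma sum_threshold_le:
  fixes pv :: "nat \<Rightarrow> real" and F :: "nat \<Rightarrow> real \<Rightarrow> real"
  assumes "finite H" "\<And>j. j \<in> H \<Longrightarrow> mono (F j)" "\<And>j. j \<in> H \<Longrightarrow> 0 \<le> F j t" "0 \<le> c"
    and le: "\<And>i. i \<in> H \<Longrightarrow> real (card {j \<in> H. pv j \<le> pv i}) - (\<Sum>j\<in>H. F j (pv i)) \<le> c"
  shows "real (card {j \<in> H. pv j \<le> t}) - (\<Sum>j\<in>H. F j t) \<le> c"
proof (cases "{j \<in> H. pv j \<le> t} = {}")
  case True
  have "0 \<le> (\<Sum>j\<in>H. F j t)" using assms by (intro sum_nonneg) auto
  then show ?thesis using True assms(4) by (simp only: card.empty)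
next
  case False
  define z where "z = Max (pv ` {j \<in> H. pv j \<le> t})"
  have "z \<in> pv ` {j \<in> H. pv j \<le> t}"
    unfolding z_def using False assms(1) by (intro Max_in) auto
  then obtain i where i: "i \<in> H" "pv i \<le> t" "z = pv i" by auto
  have "pv j \<le> pv i" if "j \<in> H" "pv j \<le> t" for j
    using that assms(1) unfolding i(3)[symmetric] z_def by (intro Max_ge) auto
  then have "{j \<in> H. pv j \<le> t} = {j \<in> H. pv j \<le> pv i}" using i by auto
  moreover have "(\<Sum>j\<in>H. F j (pv i)) \<le> (\<Sum>j\<in>H. F j t)"
    using i by (intro sum_mono monoD[OF assms(2)])
  ultimately show ?thesis using le[OF i(1)] by simp
qed

text \<open>Without a crossing, \<open>card H\<close> satisfies the condition defining
  \<open>m0_hat\<close>, because its smallest coordinates sum to at most the sum over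
  \<open>H\<close>. Hence \<open>card H \<le> h\<close>, and then \<open>H\<close> itself belongs to
  the family over which \<open>V_JER\<close> maximises.\<close>

lemma card_le_V_JER:
  fixes pv :: "nat \<Rightarrow> real" and F :: "nat \<Rightarrow> real \<Rightarrow> real"
  assumes H: "H \<subseteq> {1..m}" and pv: "\<And>i. i \<in> {1..m} \<Longrightarrow> 0 \<le> pv i \<and> pv i \<le> 1"
    and F: "\<And>i. i \<in> {1..m} \<Longrightarrow> mono (F i)" "\<And>i x. i \<in> {1..m} \<Longrightarrow> x \<in> {0..1} \<Longrightarrow> 0 \<le> F i x"
    and lam: "0 \<le> lam"
    and le: "\<And>i. i \<in> H \<Longrightarrow> real (card {j \<in> H. pv j \<le> pv i}) - (\<Sum>j\<in>H. F j (pv i)) \<le> lam * sqrt (card H)"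
    and bij: "bij_betw \<sigma> {1..m} {1..m}"
    and sorted: "\<And>k l. k \<in> {1..m} \<Longrightarrow> l \<in> {1..m} \<Longrightarrow> k \<le> l \<Longrightarrow> pv (\<sigma> k) \<le> pv (\<sigma> l)"
  shows "card (S \<inter> H) \<le> V_JER m (R_sets \<sigma>) (zeta m F lam pv \<sigma>) S"
proof -
  have fH: "finite H" by (rule finite_subset[OF H]) simp
  have thr: "real (card {j \<in> H. pv j \<le> t}) - (\<Sum>j\<in>H. F j t) \<le> lam * sqrt (card H)" if "t \<in> {0..1}" for t
  proof (rule sum_threshold_le[OF fH])
    show "mono (F j)" "0 \<le> F j t" if "j \<in> H" for j
      using F(1)[of j] F(2)[of j t] H that \<open>t \<in> {0..1}\<close> by auto
  qed (use lam le in auto)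
  define h where "h = m0_hat m F lam pv"
  have h: "card H \<le> h"
    unfolding h_def m0_hat_def
  proof (intro Max_ge)
    have "sum_smallest (card H) (Gvec m F pv t) \<le> lam * sqrt (card H)" if "t \<in> {0..1}" for t
    proof -
      have "sum_smallest (card H) (Gvec m F pv t) \<le> (\<Sum>i\<in>H. (if pv i \<le> t then 1 else 0) - F i t)"
        unfolding Gvec_def by (rule sum_smallest_le[OF H])
      also have "\<dots> = real (card {j \<in> H. pv j \<le> t}) - (\<Sum>j\<in>H. F j t)"
        using fH by (simp add: sum_subtractf sum.If_cases Int_def)
      finally show ?thesis using thr[OF that] by simp
    qed
    moreover have "card H \<le> m" using H card_mono[of "{1..m}" H] by simp
    ultimately show "card H \<in> {n \<in> {0..m}. \<forall>t\<in>{0..1}. sum_smallest n (Gvec m F pv t) \<le> lam * sqrt (real n)}"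
      by simp
  qed simp
  have "int (card (R_sets \<sigma> k \<inter> H)) \<le> zeta m F lam pv \<sigma> k" if k: "k \<in> {1..m}" for k
  proof -
    have \<sigma>: "\<sigma> l \<in> {1..m}" if "l \<in> {1..m}" for l using bij that by (auto simp: bij_betw_def)
    define t where "t = pv (\<sigma> k)"
    have t: "t \<in> {0..1}" using pv[OF \<sigma>[OF k]] by (simp add: t_def)
    have "card (R_sets \<sigma> k \<inter> H) \<le> card (R_sets \<sigma> k)"
      by (intro card_mono) (auto simp: R_sets_def)
    also have "\<dots> \<le> k" unfolding R_sets_def using card_image_le[of "{1..k}" \<sigma>] by simp
    finally have 1: "card (R_sets \<sigma> k \<inter> H) \<le> k" .
    have 2: "card (R_sets \<sigma> k \<inter> H) \<le> h"
      using h card_mono[OF fH, of "R_sets \<sigma> k \<inter> H"] by simp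
    have "R_sets \<sigma> k \<inter> H \<subseteq> {j \<in> H. pv j \<le> t}"
      using k sorted by (auto simp: R_sets_def t_def)
    then have "real (card (R_sets \<sigma> k \<inter> H)) \<le> card {j \<in> H. pv j \<le> t}"
      using fH by (auto intro!: card_mono)
    also have "\<dots> \<le> (\<Sum>j\<in>H. F j t) + lam * sqrt (card H)" using thr[OF t] by simp
    also have "(\<Sum>j\<in>H. F j t) \<le> sum_largest (card H) (Fvec m F t)"
      unfolding Fvec_def by (rule sum_largest_ge[OF H])
    \<comment> \<open>Nonnegativity of \<open>F\<close> makes the sum monotone in the number of
      terms, so the unknown \<open>card H\<close> may be replaced by \<open>h\<close>.\<close>
    also have "\<dots> \<le> sum_largest h (Fvec m F t)"
      using F t by (intro sum_largest_mono h) (auto simp: Fvec_def)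
    also have "lam * sqrt (card H) \<le> sqrt h * lam"
      using h lam by (simp add: mult.commute mult_left_mono)
    finally have "int (card (R_sets \<sigma> k \<inter> H)) \<le> \<lfloor>sum_largest h (Fvec m F t) + sqrt h * lam\<rfloor>"
      by (simp add: le_floor_iff)
    with 1 2 show ?thesis by (simp add: zeta_def Let_def h_def t_def)
  qed
  then have "H \<in> JER_family m (R_sets \<sigma>) (zeta m F lam pv \<sigma>)"
    using H by (simp add: JER_family_def)
  moreover have "finite (JER_family m (R_sets \<sigma>) (zeta m F lam pv \<sigma>))"
    by (rule finite_subset[of _ "Pow {1..m}"]) (auto simp: JER_family_def)
  ultimately show ?thesis
    unfolding V_JER_def by (intro Max_ge) auto
qed

section \<open>Independent real random variables\<close>

text \<open>A nontrivial sublevel set is a half-line with supremum \<open>z\<close>. If it contains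
  \<open>z\<close>, its mass is the summed distribution function at \<open>z\<close>; otherwise it
  is the left limit there. This replaces the probability integral transform in the presence of
  atoms.\<close>

lemma sum_measure_sublevel_le:
  fixes \<mu> :: "'i \<Rightarrow> real measure"
  assumes "finite I" and \<mu>: "\<And>i. i \<in> I \<Longrightarrow> real_distribution (\<mu> i)" and s: "0 \<le> s"
  shows "(\<Sum>i\<in>I. measure (\<mu> i) {x. (\<Sum>i\<in>I. cdf (\<mu> i) x) < s}) \<le> s"
proof -
  define G where "G x = (\<Sum>i\<in>I. cdf (\<mu> i) x)" for x
  define T where "T = {x. G x < s}"
  have fb: "finite_borel_measure (\<mu> i)" if "i \<in> I" for i
    using real_distribution.finite_borel_measure_M[OF \<mu>[OF that]] .
  have mono: "G x \<le> G y" if "x \<le> y" for x y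
    unfolding G_def using fb that by (intro sum_mono finite_borel_measure.cdf_nondecreasing)
  then have down: "y \<in> T" if "x \<in> T" "y \<le> x" for x y
    using that by (force simp: T_def dest: mono)
  have "(\<Sum>i\<in>I. measure (\<mu> i) T) \<le> s"
  proof (cases "T = {} \<or> T = UNIV")
    case True
    then show ?thesis
    proof
      assume "T = UNIV"
      have "(G \<longlongrightarrow> (\<Sum>i\<in>I. 1)) at_top"
        unfolding G_def by (intro tendsto_sum real_distribution.cdf_lim_at_top_prob \<mu>)
      then have "(\<Sum>i\<in>I. 1) \<le> s"
        by (rule tendsto_upperbound) (use \<open>T = UNIV\<close> in \<open>auto simp: T_def intro!: always_eventually less_imp_le\<close>)
      moreover have "(\<Sum>i\<in>I. measure (\<mu> i) T) \<le> (\<Sum>i\<in>I. 1)"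
        using real_distribution.axioms(1)[OF \<mu>] by (intro sum_mono prob_space.prob_le_1) auto
      ultimately show ?thesis by linarith
    qed (use s in simp)
  next
    case False
    then obtain x0 y0 where xy: "x0 \<in> T" "y0 \<notin> T" by blast
    have bdd: "x \<le> y0" if "x \<in> T" for x
      using down[OF that, of y0] xy by fastforce
    then have bdd': "bdd_above T" by (rule bdd_aboveI)
    define z where "z = Sup T"
    have le: "x \<le> z" if "x \<in> T" for x
      unfolding z_def by (rule cSup_upper[OF that bdd'])
    have less: "x \<in> T" if "x < z" for x
    proof -
      have "\<exists>y\<in>T. x < y"
        using that less_cSup_iff[of T x] xy(1) bdd' unfolding z_def by blast
      then obtain y where "y \<in> T" "x < y" by blast
      then show ?thesis using down by auto
    qed
    show ?thesis
    proof (cases "z \<in> T")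
      case True
      then have "T = {..z}" using le down by auto
      then have "(\<Sum>i\<in>I. measure (\<mu> i) T) = G z" by (simp add: G_def cdf_def)
      then show ?thesis using True by (simp add: T_def)
    next
      case F: False
      then have "T = {..<z}" using le less by (fastforce simp: order_less_le)
      moreover have "(G \<longlongrightarrow> (\<Sum>i\<in>I. measure (\<mu> i) {..<z})) (at_left z)"
        unfolding G_def by (intro tendsto_sum finite_borel_measure.cdf_at_left fb)
      then have "(\<Sum>i\<in>I. measure (\<mu> i) {..<z}) \<le> s"
      proof (rule tendsto_upperbound)
        show "\<forall>\<^sub>F x in at_left z. G x \<le> s"
          using eventually_at_left_real[of "z - 1" z]
          by (rule eventually_mono) (use less in \<open>auto simp: T_def intro: less_imp_le\<close>)
      qed simp
      ultimately show ?thesis by simp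
    qed
  qed
  then show ?thesis by (simp add: T_def G_def)
qed

context prob_space
begin

text \<open>The cell of \<open>x\<close> is \<open>\<lfloor>G x / \<eta>\<rfloor>\<close>, where \<open>G\<close> is the sum of the distribution functions; atoms need no special treatment.\<close>

lemma indep_crossing_slack_le:
  fixes X :: "'i \<Rightarrow> 'a \<Rightarrow> real"
  assumes I: "finite I" "I \<noteq> {}" and ind: "indep_vars (\<lambda>_. borel) X I" and \<eta>: "0 < \<eta>" "\<eta> \<le> c"
    and \<Phi>: "\<And>x. (\<Sum>j\<in>I. prob {\<omega> \<in> space M. X j \<omega> \<le> x}) \<le> \<Phi> x"
  shows "prob {\<omega> \<in> space M. \<exists>i\<in>I. c < real (card {j \<in> I. X j \<omega> \<le> X i \<omega>}) - \<Phi> (X i \<omega>)}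
    \<le> exp (1 - 2 * (c - \<eta>)\<^sup>2 / card I)"
proof -
  define n where "n = card I"
  define G where "G x = (\<Sum>j\<in>I. prob {\<omega> \<in> space M. X j \<omega> \<le> x})" for x
  have n: "0 < n" using I by (simp add: n_def card_gt_0_iff)
  have rv [measurable]: "X i \<in> borel_measurable M" if "i \<in> I" for i
    using ind that by (auto simp: indep_vars_def)
  have G_mono: "G x \<le> G y" if "x \<le> y" for x y
    unfolding G_def using that by (intro sum_mono finite_measure_mono) auto
  then have G_meas [measurable]: "G \<in> borel_measurable borel"
    by (intro borel_measurable_mono monoI)
  have G_bounds: "0 \<le> G x" "G x \<le> n" for x
  proof -
    show "0 \<le> G x" unfolding G_def by (intro sum_nonneg) auto
    have "G x \<le> (\<Sum>j\<in>I. 1)" unfolding G_def by (intro sum_mono) auto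
    then show "G x \<le> n" by (simp add: n_def)
  qed
  define \<kappa> where "\<kappa> x = nat \<lfloor>G x / \<eta>\<rfloor>" for x
  define L where "L = Suc (nat \<lfloor>n / \<eta>\<rfloor>)"
  have \<kappa>_mono: "\<kappa> x \<le> \<kappa> y" if "x \<le> y" for x y
    unfolding \<kappa>_def using G_mono[OF that] \<eta> by (intro nat_mono floor_mono divide_right_mono) auto
  have \<kappa>_less: "\<kappa> x < L" for x
    unfolding \<kappa>_def L_def less_Suc_eq_le using G_bounds \<eta>
    by (intro nat_mono floor_mono divide_right_mono) auto
  have \<kappa>_le: "\<kappa> x \<le> l \<longleftrightarrow> G x < real (Suc l) * \<eta>" for x l
  proof -
    have "\<kappa> x \<le> l \<longleftrightarrow> \<lfloor>G x / \<eta>\<rfloor> < int l + 1" by (auto simp: \<kappa>_def)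
    also have "\<dots> \<longleftrightarrow> G x / \<eta> < real (Suc l)" by (simp add: floor_less_iff add.commute)
    finally show ?thesis using \<eta> by (simp add: divide_less_eq)
  qed
  have \<kappa>_ge: "real (\<kappa> x) * \<eta> \<le> G x" for x
  proof -
    have "real (\<kappa> x) \<le> G x / \<eta>" using G_bounds \<eta> by (simp add: \<kappa>_def)
    then show ?thesis using \<eta> by (simp add: field_simps)
  qed
  have \<kappa>_sets [measurable]: "{x. \<kappa> x = l} \<in> sets borel" for l
    unfolding \<kappa>_def by measurable
  have ev: "X i -` {x. \<kappa> x = l} \<inter> space M \<in> events" if "i \<in> I" for i l
    by (rule measurable_sets[OF rv[OF that] \<kappa>_sets])
  define q where "q i l = prob (X i -` {x. \<kappa> x = l} \<inter> space M)" for i l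
  have q_cum: "(\<Sum>l'\<le>l. q i l') = prob (X i -` {x. G x < real (Suc l) * \<eta>} \<inter> space M)" if "i \<in> I" for i l
  proof -
    have "(\<Sum>l'\<le>l. q i l') = prob (\<Union>l'\<in>{..l}. X i -` {x. \<kappa> x = l'} \<inter> space M)"
      unfolding q_def
      by (rule finite_measure_finite_Union[symmetric])
        (simp, use ev[OF that] in blast, auto simp: disjoint_family_on_def)
    also have "(\<Union>l'\<in>{..l}. X i -` {x. \<kappa> x = l'} \<inter> space M) = X i -` {x. G x < real (Suc l) * \<eta>} \<inter> space M"
      unfolding \<kappa>_le[symmetric] by auto
    finally show ?thesis .
  qed
  have q_sum: "(\<Sum>l<L. q i l) = 1" if "i \<in> I" for i
  proof -
    have "(\<Sum>l<L. q i l) = prob (\<Union>l'\<in>{..<L}. X i -` {x. \<kappa> x = l'} \<inter> space M)"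
      unfolding q_def
      by (rule finite_measure_finite_Union[symmetric])
        (simp, use ev[OF that] in blast, auto simp: disjoint_family_on_def)
    also have "(\<Union>l'\<in>{..<L}. X i -` {x. \<kappa> x = l'} \<inter> space M) = space M"
      using \<kappa>_less by auto
    finally show ?thesis by (simp add: prob_space)
  qed
  \<comment> \<open>The mean number of variables up to cell \<open>l\<close> is the mass of a
    sublevel set of \<open>G\<close>.\<close>
  have q_total: "(\<Sum>i\<in>I. \<Sum>l'\<le>l. q i l') \<le> real (Suc l) * \<eta>" for l
  proof -
    let ?\<mu> = "\<lambda>i. distr M borel (X i)"
    have cdf: "(\<Sum>i\<in>I. cdf (?\<mu> i) x) = G x" for x
      unfolding G_def cdf_def
      by (intro sum.cong refl) (auto simp: measure_distr intro!: arg_cong[where f = prob])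
    have "(\<Sum>i\<in>I. \<Sum>l'\<le>l. q i l') = (\<Sum>i\<in>I. measure (?\<mu> i) {x. G x < real (Suc l) * \<eta>})"
      by (intro sum.cong refl) (simp add: q_cum measure_distr)
    also have "\<dots> \<le> real (Suc l) * \<eta>"
      using sum_measure_sublevel_le[OF I(1), of ?\<mu> "real (Suc l) * \<eta>"] \<eta> unfolding cdf by auto
    finally show ?thesis .
  qed
  define bad where "bad x \<longleftrightarrow> (\<exists>l<L. (c - \<eta>) + (\<Sum>i\<in>I. \<Sum>l'\<le>l. q i l') \<le> card {i \<in> I. x i \<le> l})" for x
  define cell where "cell x = (\<Inter>i\<in>I. X i -` {y. \<kappa> y = x i} \<inter> space M)" for x
  have cell_sets: "cell x \<in> sets M" for x
    unfolding cell_def using I by (intro sets.finite_INT measurable_sets[OF rv]) auto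
  have fin: "finite {x \<in> I \<rightarrow>\<^sub>E {..<L}. bad x}" using I by (simp add: finite_PiE)
  have "prob {\<omega> \<in> space M. \<exists>i\<in>I. c < real (card {j \<in> I. X j \<omega> \<le> X i \<omega>}) - \<Phi> (X i \<omega>)}
     \<le> prob (\<Union>x\<in>{x \<in> I \<rightarrow>\<^sub>E {..<L}. bad x}. cell x)"
  proof (rule finite_measure_mono)
    show "{\<omega> \<in> space M. \<exists>i\<in>I. c < real (card {j \<in> I. X j \<omega> \<le> X i \<omega>}) - \<Phi> (X i \<omega>)}
       \<subseteq> (\<Union>x\<in>{x \<in> I \<rightarrow>\<^sub>E {..<L}. bad x}. cell x)"
    proof
      fix \<omega> assume "\<omega> \<in> {\<omega> \<in> space M. \<exists>i\<in>I. c < real (card {j \<in> I. X j \<omega> \<le> X i \<omega>}) - \<Phi> (X i \<omega>)}"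
      then obtain i where \<omega>: "\<omega> \<in> space M" and i: "i \<in> I" "c < real (card {j \<in> I. X j \<omega> \<le> X i \<omega>}) - \<Phi> (X i \<omega>)"
        by auto
      define x where "x = (\<lambda>j\<in>I. \<kappa> (X j \<omega>))"
      have "card {j \<in> I. X j \<omega> \<le> X i \<omega>} \<le> card {j \<in> I. x j \<le> \<kappa> (X i \<omega>)}"
        using I \<kappa>_mono by (intro card_mono) (auto simp: x_def)
      \<comment> \<open>Rounding never lowers the count and raises the mean by at most one cell
        width, which is the loss from \<open>c\<close> to \<open>c - \<eta>\<close>.\<close>
      moreover have "(\<Sum>i\<in>I. \<Sum>l'\<le>\<kappa> (X i' \<omega>). q i l') \<le> G (X i' \<omega>) + \<eta>" for i'
        using q_total[of "\<kappa> (X i' \<omega>)"] \<kappa>_ge[of "X i' \<omega>"] by (simp add: algebra_simps)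
      from this[of i] have "(\<Sum>j\<in>I. \<Sum>l'\<le>\<kappa> (X i \<omega>). q j l') \<le> G (X i \<omega>) + \<eta>" .
      ultimately have "(c - \<eta>) + (\<Sum>j\<in>I. \<Sum>l'\<le>\<kappa> (X i \<omega>). q j l') \<le> card {j \<in> I. x j \<le> \<kappa> (X i \<omega>)}"
        using i(2) \<Phi>[of "X i \<omega>"] unfolding G_def by linarith
      then have "bad x" unfolding bad_def using \<kappa>_less by blast
      moreover have "x \<in> I \<rightarrow>\<^sub>E {..<L}" using \<kappa>_less by (auto simp: x_def)
      moreover have "\<omega> \<in> cell x" using \<omega> I by (auto simp: cell_def x_def)
      ultimately show "\<omega> \<in> (\<Union>x\<in>{x \<in> I \<rightarrow>\<^sub>E {..<L}. bad x}. cell x)" by blast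
    qed
  qed (use fin cell_sets in \<open>auto intro!: sets.finite_UN\<close>)
  also have "\<dots> \<le> (\<Sum>x\<in>{x \<in> I \<rightarrow>\<^sub>E {..<L}. bad x}. prob (cell x))"
    using fin cell_sets by (intro finite_measure_subadditive_finite) auto
  also have "\<dots> = (\<Sum>x\<in>{x \<in> I \<rightarrow>\<^sub>E {..<L}. bad x}. \<Prod>i\<in>I. q i (x i))"
    unfolding cell_def q_def by (intro sum.cong refl indep_varsD_finite[OF ind] I) auto
  also have "\<dots> = (\<Sum>x\<in>I \<rightarrow>\<^sub>E {..<L}. if bad x then \<Prod>i\<in>I. q i (x i) else 0)"
    using I by (intro sum.inter_filter finite_PiE) auto
  also have "\<dots> = product_sum I L q (\<lambda>x. of_bool (bad x))"
    unfolding product_sum_def by (intro sum.cong) auto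
  also have "\<dots> \<le> exp (1 - 2 * (c - \<eta>)\<^sup>2 / n)"
    unfolding bad_def using I n \<eta> q_sum
    by (intro discrete_crossing_le) (auto simp: n_def q_def)
  finally show ?thesis by (simp add: n_def)
qed

text \<open>The event does not involve the cell width \<eta>, which can therefore tend to 0 in the
  bound.\<close>

theorem indep_crossing_le:
  fixes X :: "'i \<Rightarrow> 'a \<Rightarrow> real"
  assumes I: "finite I" "I \<noteq> {}" and ind: "indep_vars (\<lambda>_. borel) X I" and c: "0 < c"
    and \<Phi>: "\<And>x. (\<Sum>j\<in>I. prob {\<omega> \<in> space M. X j \<omega> \<le> x}) \<le> \<Phi> x"
  shows "prob {\<omega> \<in> space M. \<exists>i\<in>I. c < real (card {j \<in> I. X j \<omega> \<le> X i \<omega>}) - \<Phi> (X i \<omega>)}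
    \<le> exp (1 - 2 * c\<^sup>2 / card I)"
proof -
  have "((\<lambda>\<eta>. exp (1 - 2 * (c - \<eta>)\<^sup>2 / card I)) \<longlongrightarrow> exp (1 - 2 * (c - 0)\<^sup>2 / card I)) (at_right 0)"
    using I by (intro tendsto_intros) auto
  then have "prob {\<omega> \<in> space M. \<exists>i\<in>I. c < real (card {j \<in> I. X j \<omega> \<le> X i \<omega>}) - \<Phi> (X i \<omega>)}
    \<le> exp (1 - 2 * (c - 0)\<^sup>2 / card I)"
  proof (rule tendsto_lowerbound)
    show "\<forall>\<^sub>F \<eta> in at_right 0. prob {\<omega> \<in> space M. \<exists>i\<in>I. c < real (card {j \<in> I. X j \<omega> \<le> X i \<omega>}) - \<Phi> (X i \<omega>)}
       \<le> exp (1 - 2 * (c - \<eta>)\<^sup>2 / card I)"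
      using eventually_at_right_real[OF c]
      by (rule eventually_mono) (intro indep_crossing_slack_le[OF I ind _ _ \<Phi>], auto)
  qed simp
  then show ?thesis by simp
qed

end

theorem mainTheorem18:
  fixes M :: "'w measure" and m :: nat and H0 :: "nat set"
    and p :: "nat \<Rightarrow> 'w \<Rightarrow> real" and F :: "nat \<Rightarrow> real \<Rightarrow> real"
    and \<sigma> :: "'w \<Rightarrow> nat \<Rightarrow> nat" and \<alpha> :: real
  assumes "prob_space M"
    and "H0 \<subseteq> {1..m}"
    and "\<forall>i \<in> {1..m}. p i \<in> borel_measurable M"
    and "\<forall>i \<in> {1..m}. \<forall>\<omega> \<in> space M. 0 \<le> p i \<omega> \<and> p i \<omega> \<le> 1"
    and "prob_space.indep_vars M (\<lambda>_. borel) p H0"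
    and "\<forall>i \<in> {1..m}. mono (F i)"
    and "\<forall>i \<in> {1..m}. \<forall>x \<in> {0..1}. 0 \<le> F i x"
    and "\<forall>i \<in> H0. \<forall>x. measure M {\<omega> \<in> space M. p i \<omega> \<le> x} \<le> F i x"
    and "0 < \<alpha>" and "\<alpha> \<le> 1"
    and "\<forall>\<omega> \<in> space M. bij_betw (\<sigma> \<omega>) {1..m} {1..m} \<and>
           (\<forall>k \<in> {1..m}. \<forall>l \<in> {1..m}. k \<le> l \<longrightarrow> p (\<sigma> \<omega> k) \<omega> \<le> p (\<sigma> \<omega> l) \<omega>)"
  shows "\<exists>E \<in> sets M. 1 - \<alpha> \<le> measure M E \<and>
           E \<subseteq> {\<omega> \<in> space M. \<forall>S. S \<subseteq> {1..m} \<longrightarrow>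
                 card (S \<inter> H0) \<le> V_JER m (R_sets (\<sigma> \<omega>))
                     (zeta m F (lambda_tilde \<alpha>) (\<lambda>i. p i \<omega>) (\<sigma> \<omega>)) S}"
proof -
  interpret prob_space M by fact
  have fin: "finite H0" using assms(2) by (rule finite_subset) simp
  have H0: "i \<in> {1..m}" if "i \<in> H0" for i using assms(2) that by auto
  define lam where "lam = lambda_tilde \<alpha>"
  have ln: "0 \<le> ln (1 / \<alpha>)" using assms(9,10) by simp
  then have lam: "0 < lam" "lam\<^sup>2 = (1 + ln (1 / \<alpha>)) / 2"
    by (auto simp: lam_def lambda_tilde_def)
  define c where "c = lam * sqrt (card H0)"
  \<comment> \<open>Crossings are recorded only at the p-values indexed by \<open>H0\<close>, so
    \<open>C\<close> is a finite union of measurable events; its complement is the required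
    \<open>E\<close>.\<close>
  define C where "C = {\<omega> \<in> space M. \<exists>i\<in>H0. c < real (card {j \<in> H0. p j \<omega> \<le> p i \<omega>}) - (\<Sum>j\<in>H0. F j (p i \<omega>))}"
  have meas: "Measurable.pred M (\<lambda>\<omega>. c < real (card {j \<in> H0. p j \<omega> \<le> p i \<omega>}) - (\<Sum>j\<in>H0. F j (p i \<omega>)))"
    if "i \<in> H0" for i
  proof -
    have p [measurable]: "p j \<in> borel_measurable M" if "j \<in> H0" for j using assms(3) H0 that by blast
    have [measurable]: "F j \<in> borel_measurable borel" if "j \<in> H0" for j
      using assms(6) H0 that by (intro borel_measurable_mono) auto
    note that [measurable]
    have "real (card {j \<in> H0. p j \<omega> \<le> p i \<omega>}) = (\<Sum>j\<in>H0. if p j \<omega> \<le> p i \<omega> then 1 else 0)" for \<omega>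
      using fin by (simp add: sum.If_cases Int_def)
    then show ?thesis using that by simp
  qed
  have C_sets: "C \<in> sets M"
    unfolding C_def using meas fin by (intro predE pred_intros_finite) auto
  have "prob C \<le> \<alpha>"
  proof (cases "H0 = {}")
    case True
    then show ?thesis using assms(9) by (simp add: C_def)
  next
    case False
    then have n: "0 < card H0" using fin by (simp add: card_gt_0_iff)
    have "prob C \<le> exp (1 - 2 * c\<^sup>2 / card H0)"
      unfolding C_def
    proof (rule indep_crossing_le[OF fin False assms(5)])
      show "(\<Sum>j\<in>H0. prob {\<omega> \<in> space M. p j \<omega> \<le> x}) \<le> (\<Sum>j\<in>H0. F j x)" for x
        using assms(8) by (intro sum_mono) auto
    qed (use lam n in \<open>simp add: c_def\<close>)
    \<comment> \<open>\<open>lambda_tilde \<alpha>\<close> is the nonnegative solution of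
      \<open>1 - 2 * lam\<^sup>2 = ln \<alpha>\<close>.\<close>
    also have "1 - 2 * c\<^sup>2 / card H0 = ln \<alpha>"
      using n lam(2) assms(9) by (simp add: c_def power_mult_distrib ln_div field_simps)
    finally show ?thesis using assms(9) by simp
  qed
  then have "1 - \<alpha> \<le> prob (space M - C)"
    using C_sets by (simp add: prob_compl)
  moreover have "card (S \<inter> H0) \<le> V_JER m (R_sets (\<sigma> \<omega>)) (zeta m F lam (\<lambda>i. p i \<omega>) (\<sigma> \<omega>)) S"
    if "\<omega> \<in> space M - C" for S \<omega>
  proof (rule card_le_V_JER[OF assms(2)])
    show "real (card {j \<in> H0. p j \<omega> \<le> p i \<omega>}) - (\<Sum>j\<in>H0. F j (p i \<omega>)) \<le> lam * sqrt (card H0)"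
      if "i \<in> H0" for i
      using \<open>\<omega> \<in> space M - C\<close> that by (auto simp: C_def c_def not_less)
  qed (use assms that lam in auto)
  ultimately show ?thesis
    using C_sets by (intro bexI[of _ "space M - C"]) (auto simp: lam_def)
qed

end
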